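(* Let $\mathfrak{q}=(q_i)_{i\ge 0}$ be a gap sequence such that, for some $q\ge 0$ and $0\le\beta<1$, $Q_k=\sum_{i=0}^{k-1}q_i=qk+O(k^\beta)$ as $k\to\infty$. Then, for every $t_0>0$ and any $\varepsilon>0$, $$\lim_{n\to\infty}\nu_n^{\mathfrak{q}}\Bigl\{\lambda\in\Lambda_{\mathfrak{q}}(n)\colon \sup_{t\ge t_0}\bigl|n^{-1/2}Y_\lambda(t\,n^{1/2})-\vartheta_q^{-1}\varphi(t\,\vartheta_q;q)\bigr|>\varepsilon\Bigr\}=0 .$$
   Context: A partition is a sequence of integers $\lambda_1\ge\lambda_2\ge\dots\ge0$ with finitely many nonzero terms; $N(\lambda)=\sum_i\lambda_i$ is its weight and $K(\lambda)=\#\{i:\lambda_i>0\}$ its length. A gap sequence $\mathfrak{q}=(q_i)_{i\ge0}$ is a sequence of non-negative integers with $q_0\ge1$. $\Lambda_{\mathfrak{q}}$ is the set of all partitions $\lambda$ such that, with $k=K(\lambda)$, $\lambda_i-\lambda_{i+1}\ge q_{k-i}$ for $i=1,\dots,k$ (the empty partition is included). $\Lambda_{\mathfrak{q}}(n)=\{\lambda\in\Lambda_{\mathfrak{q}}: N(\lambda)=n\}$ and $\nu_n^{\mathfrak{q}}$ is the uniform probability measure on $\Lambda_{\mathfrak{q}}(n)$ (defined whenever this set is non-empty). $Y_\lambda(t)=\lambda_{\lfloor t\rfloor+1}$ for $t\ge0$ (upper boundary of the Young diagram whose columns are the parts). For $q\ge0$: $\varphi(t;q)=\max\{0,-qt-\log(1-e^{-t})\}$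 for $t>0$. For $q>0$, $T_q>0$ is the unique solution of $e^{-qT_q}=1-e^{-T_q}$; $T_0=+\infty$. $\mathrm{Li}_2(x)=\sum_{k\ge1}x^k/k^2$ for $0\le x\le1$. For $q>0$, $\vartheta_q>0$ is given by $\vartheta_q^2=\tfrac12 qT_q^2+\mathrm{Li}_2(1-e^{-T_q})$; $\vartheta_0=\pi/\sqrt6$. *)

theory Defs
  imports "HOL-Probability.Probability" "HOL-Library.Landau_Symbols"
begin

text \<open>
  Partitions are sequences indexed from \<open>0\<close>: \<open>lam i\<close> is the part
  \<open>\<lambda>\<^sub>i\<^sub>+\<^sub>1\<close> of \<open>\<lambda>\<^sub>1 \<ge> \<lambda>\<^sub>2 \<ge> \<dots>\<close>.
\<close>

definition is_partition :: "(nat \<Rightarrow> nat) \<Rightarrow> bool" where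
  "is_partition lam \<longleftrightarrow> antimono lam \<and> finite {i. lam i > 0}"

definition weight :: "(nat \<Rightarrow> nat) \<Rightarrow> nat" where
  "weight lam = (\<Sum>i | lam i > 0. lam i)"

definition num_parts :: "(nat \<Rightarrow> nat) \<Rightarrow> nat" where
  "num_parts lam = card {i. lam i > 0}"

definition gap_sequence :: "(nat \<Rightarrow> nat) \<Rightarrow> bool" where
  "gap_sequence qs \<longleftrightarrow> qs 0 \<ge> 1"

text \<open>
  With \<open>k\<close> the number of parts, the condition \<open>\<lambda>\<^sub>j - \<lambda>\<^sub>j\<^sub>+\<^sub>1 \<ge> q\<^bsub>k-j\<^esub>\<close> for
  \<open>1 \<le> j \<le> k\<close> is stated below with \<open>i = j - 1\<close>, as an addition so that no
  truncated subtraction of parts occurs.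
\<close>

definition gap_partitions :: "(nat \<Rightarrow> nat) \<Rightarrow> (nat \<Rightarrow> nat) set" where
  "gap_partitions qs =
    {lam. is_partition lam \<and>
      (\<forall>i < num_parts lam. lam i \<ge> lam (i + 1) + qs (num_parts lam - (i + 1)))}"

definition gap_partitions_of :: "(nat \<Rightarrow> nat) \<Rightarrow> nat \<Rightarrow> (nat \<Rightarrow> nat) set" where
  "gap_partitions_of qs n = {lam \<in> gap_partitions qs. weight lam = n}"

text \<open>
  The index set is finite, and it is non-empty as soon as \<open>n \<ge> q\<^sub>0\<close> (one part of
  size \<open>n\<close>); for the finitely many \<open>n\<close> for which it may be empty this is the measure on
  the empty space.
\<close>

definition gap_measure :: "(nat \<Rightarrow> nat) \<Rightarrow> nat \<Rightarrow> (nat \<Rightarrow> nat) measure" where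
  "gap_measure qs n = uniform_count_measure (gap_partitions_of qs n)"

definition young_boundary :: "(nat \<Rightarrow> nat) \<Rightarrow> real \<Rightarrow> real" where
  "young_boundary lam t = real (lam (nat \<lfloor>t\<rfloor>))"

definition limit_shape :: "real \<Rightarrow> real \<Rightarrow> real" where
  "limit_shape t q = max 0 (- q * t - ln (1 - exp (- t)))"

text \<open>Only meaningful for \<open>q > 0\<close>; see \<open>ex1_T_const\<close>.\<close>

definition T_const :: "real \<Rightarrow> real" where
  "T_const q = (THE T. T > 0 \<and> exp (- q * T) = 1 - exp (- T))"

definition Li2 :: "real \<Rightarrow> real" where
  "Li2 x = (\<Sum>k. x ^ Suc k / (real (Suc k))\<^sup>2)"

definition theta :: "real \<Rightarrow> real" where
  "theta q =
    (if q = 0 then pi / sqrt 6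
     else sqrt (q * (T_const q)\<^sup>2 / 2 + Li2 (1 - exp (- T_const q))))"

lemma ex1_T_const:
  fixes q :: real
  assumes "q > 0"
  shows "\<exists>!T. T > 0 \<and> exp (- q * T) = 1 - exp (- T)"
proof -
  define f where "f T = exp (- q * T) + exp (- T)" for T :: real
  have decr: "f b < f a" if "a < b" for a b
    unfolding f_def using that assms by (intro add_strict_mono) auto
  define b where "b = ln 2 / q + ln 2 + 1"
  have half: "exp (- x) < 1 / 2" if "x > ln 2" for x :: real
  proof -
    have "exp (- x) < exp (- ln 2)" using that by simp
    then show ?thesis by (simp add: exp_minus)
  qed
  have pos: "ln 2 / q > 0" using assms by simp
  have "q * b = ln 2 + q * (ln 2 + 1)"
    using assms by (simp add: b_def field_simps)
  moreover have "q * (ln 2 + 1) > 0" using assms by (simp add: add_pos_pos)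
  ultimately have "q * b > ln 2" by linarith
  moreover have "b > ln 2" using pos by (simp add: b_def)
  moreover have "b > 0"
    using pos ln_gt_zero[of "2::real"] unfolding b_def by linarith
  ultimately have b: "f b < 1" "b > 0"
    using half[of "q * b"] half[of b] by (auto simp: f_def)
  have cont: "continuous_on {0..b} f"
    unfolding f_def by (intro continuous_intros)
  obtain T where T: "T \<ge> 0" "f T = 1"
    using IVT2'[of f b 1 0] b cont by (auto simp: f_def)
  have "T \<noteq> 0"
    using T(2) by (auto simp: f_def)
  with T have "T > 0 \<and> exp (- q * T) = 1 - exp (- T)"
    by (auto simp: f_def)
  moreover have "T' = T" if "exp (- q * T') = 1 - exp (- T')" for T'
    using that T(2) decr[of T T'] decr[of T' T] by (cases T T' rule: linorder_cases) (auto simp: f_def)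
  ultimately show ?thesis by blast
qed

end

theory Submission
  imports Defs "HOL-Real_Asymp.Real_Asymp"
begin

text \<open>
  Write \<open>Q\<^sub>k\<close> for the sum of the first \<open>k\<close> gaps, \<open>S\<^sub>k = Q\<^sub>1 + \<dots> + Q\<^sub>k\<close>, \<open>\<theta>\<close> for
  \<open>theta q\<close>, \<open>\<phi> u\<close> for \<open>limit_shape u q\<close>, and \<open>a(n)\<close> for the number of admissible
  partitions of \<open>n\<close>.  The proof is a large deviation argument: \<open>a(n)\<close> is
  \<open>exp ((2\<theta> + o(1)) \<surd>n)\<close>, while for each index \<open>p\<close> of order at least \<open>\<surd>n\<close> the partitions whose
  part \<open>\<lambda>\<^sub>p\<close> lies far from its predicted value number at most \<open>exp ((2\<theta> - \<kappa>) \<surd>n)\<close>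
  for some \<open>\<kappa> > 0\<close>.  As only \<open>n + 1\<close> indices matter, a union bound finishes the proof, and
  every estimate may lose a factor \<open>exp (o(\<surd>n))\<close>.

  A partition with exactly \<open>k\<close> parts is the minimal one, of weight \<open>S\<^sub>k\<close>, to which
  free non-negative excesses \<open>r\<^sub>j\<close> of the gaps are added; \<open>r\<^sub>j\<close> contributes
  \<open>j r\<^sub>j\<close> to the weight and \<open>r\<^sub>j\<close> to each of the first \<open>j\<close> parts.  Hence sums of
  \<open>exp (c \<lambda>\<^sub>p - s N(\<lambda>))\<close> over partitions with \<open>k\<close> parts are explicit products of geometric
  series (\<open>sum_exp_from_gaps\<close>).  With \<open>g u = - q u - ln (1 - exp (- u))\<close>, so that
  \<open>\<phi> = max 0 g\<close>, and with \<open>Q\<^sub>j\<close> close to \<open>q j\<close>, the logarithm of the product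
  is about the sum of \<open>g (s j)\<close> over the \<open>j\<close> up to \<open>p\<close> and of \<open>g (s j - c)\<close> over the
  \<open>j\<close> from \<open>p + 1\<close> to \<open>k\<close>: tilting by \<open>\<lambda>\<^sub>p\<close> is a shift of the argument.
  Replacing \<open>g\<close> by \<open>\<phi>\<close> makes
  the bound independent of \<open>k\<close>, and since \<open>\<phi>\<close> is decreasing the sum is at most an integral:
  \<open>(\<theta>\<^sup>2 + c \<phi>(s p - c)) / s\<close>, because the integral of \<open>\<phi>\<close> over the half-line is \<open>\<theta>\<^sup>2\<close>
  (\<open>tail_area_0\<close>, a form of the reflection formula of the dilogarithm).  Taking
  \<open>s = \<theta> / \<surd>n\<close> and a small \<open>c\<close> of either sign, Markov's inequality gives the bound on deviating
  partitions (\<open>exponential_moment_bound\<close>, \<open>deviation_count\<close>), and \<open>c = 0\<close> gives the upper bound on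
  \<open>a(n)\<close>.

  For the lower bound on \<open>a(n)\<close>, the generating function at \<open>s = \<theta> / \<surd>N\<close> is at least
  \<open>exp ((\<theta> - o(1)) \<surd>N)\<close>, and by the upper bound on \<open>a(m)\<close> only weights \<open>m\<close> close to \<open>N\<close> can
  contribute that much.  So \<open>a(m)\<close> is large for some \<open>m\<close> close to \<open>N\<close>, and because
  \<open>a\<close> is nondecreasing (enlarge the largest part) it is large everywhere
  (\<open>gap_count_lower\<close>).
\<close>

section \<open>The dilogarithm\<close>


lemma Li2_summable:
  assumes "\<bar>x\<bar> \<le> 1"
  shows "summable (\<lambda>k. x ^ Suc k / (real (Suc k))\<^sup>2)"
proof (rule summable_comparison_test')
  show "summable (\<lambda>k. 1 / (real (Suc k))\<^sup>2)"
    using inverse_squares_sums by (simp add: sums_iff)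
  show "norm (x ^ Suc k / (real (Suc k))\<^sup>2) \<le> 1 / (real (Suc k))\<^sup>2" for k
    using power_le_one[of "\<bar>x\<bar>" "Suc k"] assms
    by (simp add: power_abs divide_right_mono del: power_Suc of_nat_Suc)
qed

lemma Li2_0 [simp]: "Li2 0 = 0"
  by (simp add: Li2_def)

lemma Li2_1: "Li2 1 = pi\<^sup>2 / 6"
  using inverse_squares_sums by (simp add: Li2_def sums_iff add.commute)

lemma Li2_nonneg: "0 \<le> x \<Longrightarrow> x \<le> 1 \<Longrightarrow> 0 \<le> Li2 x"
  unfolding Li2_def by (intro suminf_nonneg Li2_summable) auto

lemma continuous_on_Li2: "continuous_on {0..1} Li2"
proof -
  have "uniform_limit {0..1} (\<lambda>n x. \<Sum>k<n. x ^ Suc k / (real (Suc k))\<^sup>2)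
          (\<lambda>x. \<Sum>k. x ^ Suc k / (real (Suc k))\<^sup>2) sequentially"
  proof (rule Weierstrass_m_test)
    show "summable (\<lambda>k. 1 / (real (Suc k))\<^sup>2)"
      using inverse_squares_sums by (simp add: sums_iff)
    show "norm (x ^ Suc k / (real (Suc k))\<^sup>2) \<le> 1 / (real (Suc k))\<^sup>2"
      if "x \<in> {0..1}" for x :: real and k
      using power_le_one[of "x" "Suc k"] that
      by (simp add: power_abs divide_right_mono del: power_Suc of_nat_Suc)
  qed
  then show ?thesis
    unfolding Li2_def
    by (rule uniform_limit_theorem[rotated]) (auto intro!: always_eventually continuous_intros)
qed

lemma has_field_derivative_Li2:
  assumes "0 < x" "x < 1"
  shows "(Li2 has_field_derivative - ln (1 - x) / x) (at x)"
proof -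
  define f where "f n = 1 / (real (Suc n))\<^sup>2" for n
  have eq: "f n * real (Suc n) * y ^ n = y ^ n / real (Suc n)" for n and y :: real
    by (simp add: f_def power2_eq_square)
  have "((\<lambda>x. \<Sum>n. f n * x ^ Suc n) has_field_derivative
          (\<Sum>n. f n * real (Suc n) * x ^ n)) (at x)"
  proof (rule DERIV_power_series')
    show "x \<in> {-1<..<1}" "(0::real) < 1" using assms by auto
    fix y :: real assume y: "y \<in> {-1<..<1}"
    show "summable (\<lambda>n. f n * real (Suc n) * y ^ n)"
      unfolding eq
    proof (rule summable_comparison_test')
      show "summable (\<lambda>n. \<bar>y\<bar> ^ n)" using y by (intro summable_geometric) auto
      show "norm (y ^ n / real (Suc n)) \<le> \<bar>y\<bar> ^ n" for n
        by (simp add: power_abs divide_le_eq mult_le_cancel_left1)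
    qed
  qed
  also have "(\<lambda>x. \<Sum>n. f n * x ^ Suc n) = Li2"
    by (auto simp: Li2_def f_def)
  also have "(\<Sum>n. f n * real (Suc n) * x ^ n) = - ln (1 - x) / x"
  proof -
    have "ln (1 - x) = (\<Sum>n. (-1) ^ n * (1 / real (n + 1)) * ((1 - x) - 1) ^ Suc n)"
      by (rule ln_series) (use assms in auto)
    also have "(\<lambda>n. (-1) ^ n * (1 / real (n + 1)) * ((1 - x) - 1) ^ Suc n)
               = (\<lambda>n. - x * (x ^ n / real (Suc n)))"
    proof
      fix n
      have "(1 - x - 1) ^ Suc n = (-1) ^ Suc n * x ^ Suc n"
        by (simp flip: power_mult_distrib del: power_Suc)
      then show "(-1) ^ n * (1 / real (n + 1)) * ((1 - x) - 1) ^ Suc n = - x * (x ^ n / real (Suc n))"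
        by (simp flip: power_mult_distrib)
    qed
    also have "(\<Sum>n. - x * (x ^ n / real (Suc n))) = - x * (\<Sum>n. x ^ n / real (Suc n))"
    proof (rule suminf_mult)
      show "summable (\<lambda>n. x ^ n / real (Suc n))"
      proof (rule summable_comparison_test')
        show "summable (\<lambda>n. \<bar>x\<bar> ^ n)" using assms by (intro summable_geometric) auto
        show "norm (x ^ n / real (Suc n)) \<le> \<bar>x\<bar> ^ n" for n
          by (simp add: power_abs divide_le_eq mult_le_cancel_left1)
      qed
    qed
    finally show ?thesis using assms by (simp add: eq del: of_nat_Suc)
  qed
  finally show ?thesis .
qed

text \<open>
  The derivative of the left-hand side vanishes, and its value at \<open>0\<close> is \<open>Li2 1\<close>.
\<close>
lemma Li2_reflection:
  assumes "0 < z" "z < 1"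
  shows "Li2 z + Li2 (1 - z) + ln z * ln (1 - z) = pi\<^sup>2 / 6"
proof -
  define f where "f z = Li2 z + Li2 (1 - z) + ln z * ln (1 - z)" for z
  have d: "(f has_field_derivative 0) (at x)" if x: "x \<in> {0<..<1}" for x
  proof -
    have "((\<lambda>x. Li2 (1 - x)) has_field_derivative (- ln (1 - (1 - x)) / (1 - x)) * (-1)) (at x)"
      by (rule DERIV_chain2[OF has_field_derivative_Li2]) (use x in \<open>auto intro!: derivative_eq_intros\<close>)
    moreover have "((\<lambda>x. ln x * ln (1 - x)) has_field_derivative ln (1 - x) / x - ln x / (1 - x)) (at x)"
      using x by (auto intro!: derivative_eq_intros simp: divide_simps)
    ultimately have "(f has_field_derivative
        - ln (1 - x) / x + (- ln (1 - (1 - x)) / (1 - x)) * (-1) + (ln (1 - x) / x - ln x / (1 - x))) (at x)"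
      unfolding f_def using has_field_derivative_Li2[of x] x by (intro DERIV_add) auto
    then show ?thesis by simp
  qed
  have "\<exists>c. \<forall>x\<in>{0<..<1}. f x = c"
    by (rule has_field_derivative_zero_constant) (use has_field_derivative_at_within[OF d] in auto)
  then obtain c where c: "f x = c" if "x \<in> {0<..<1}" for x by blast
  have ev: "\<forall>\<^sub>F x in at_right (0::real). x \<in> {0<..<1}"
    by (rule eventually_at_right_real) simp
  have lim: "(Li2 \<longlongrightarrow> Li2 a) (at a within {0..1})" if "a \<in> {0..1}" for a
    using continuous_on_Li2 that by (auto simp: continuous_on_def)
  have "((\<lambda>x. Li2 x + Li2 (1 - x) + ln x * ln (1 - x)) \<longlongrightarrow> Li2 0 + Li2 1 + 0) (at_right 0)"
  proof (intro tendsto_intros)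
    have "filterlim (\<lambda>x. x) (at 0 within {0..1}) (at_right (0::real))"
      unfolding filterlim_at using ev by (auto elim!: eventually_mono intro: tendsto_ident_at)
    from filterlim_compose[OF lim this] show "(Li2 \<longlongrightarrow> Li2 0) (at_right 0)" by simp
    have "((\<lambda>x. 1 - x) \<longlongrightarrow> 1 - (0::real)) (at_right 0)" by (intro tendsto_intros)
    then have "filterlim (\<lambda>x. 1 - x) (at 1 within {0..1}) (at_right (0::real))"
      unfolding filterlim_at using ev by (auto elim!: eventually_mono)
    from filterlim_compose[OF lim this] show "((\<lambda>x. Li2 (1 - x)) \<longlongrightarrow> Li2 1) (at_right 0)" by simp
    show "((\<lambda>x. ln x * ln (1 - x)) \<longlongrightarrow> 0) (at_right (0::real))" by real_asymp
  qed
  then have "(f \<longlongrightarrow> pi\<^sup>2 / 6) (at_right 0)"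
    by (simp add: f_def[abs_def] Li2_1)
  moreover have "(f \<longlongrightarrow> c) (at_right 0)"
    by (rule tendsto_eventually) (use ev c in \<open>auto elim!: eventually_mono\<close>)
  ultimately have "c = pi\<^sup>2 / 6"
    using tendsto_unique trivial_limit_at_right_real by blast
  with c[of z] assms show ?thesis by (simp add: f_def)
qed

section \<open>The area under the limit shape\<close>

text \<open>
  The function whose positive part is the limit shape.  It is the continuous analogue of
  \<open>- s Q\<^sub>j - ln (1 - exp (- s j))\<close> at \<open>u = s j\<close>, the logarithm of the factor by which the generating function
  of partitions with \<open>j\<close> parts exceeds that of partitions with \<open>j - 1\<close> parts.
\<close>
definition profile :: "real \<Rightarrow> real \<Rightarrow> real" where
  "profile q u = - q * u - ln (1 - exp (- u))"

lemma limit_shape_eq_profile: "limit_shape u q = max 0 (profile q u)"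
  by (simp add: limit_shape_def profile_def)

lemma limit_shape_nonneg: "0 \<le> limit_shape u q"
  by (simp add: limit_shape_def)

lemma has_field_derivative_profile:
  assumes "0 < u"
  shows "(profile q has_field_derivative - q - 1 / (exp u - 1)) (at u)"
proof -
  have "exp (- u) / (1 - exp (- u)) = 1 / (exp u - 1)"
    using assms by (simp add: exp_minus divide_simps)
  then show ?thesis
    unfolding profile_def[abs_def] using assms
    by (auto intro!: derivative_eq_intros)
qed

lemma profile_strict_antimono:
  assumes "0 \<le> q" "0 < a" "a < b"
  shows "profile q b < profile q a"
proof -
  have "ln (1 - exp (- a)) < ln (1 - exp (- b))" using assms by simp
  moreover have "q * a \<le> q * b" using assms by (intro mult_left_mono) auto
  ultimately show ?thesis by (simp add: profile_def)
qed

lemma profile_antimono: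
  assumes "0 \<le> q" "0 < a" "a \<le> b"
  shows "profile q b \<le> profile q a"
  using profile_strict_antimono[OF assms(1,2), of b] assms(3) by (cases "a = b") auto

lemma limit_shape_antimono:
  assumes "0 \<le> q" "0 < a" "a \<le> b"
  shows "limit_shape b q \<le> limit_shape a q"
  unfolding limit_shape_eq_profile using profile_antimono[OF assms] by simp

lemma limit_shape_lipschitz:
  assumes "0 \<le> q" "0 < a"
  obtains L where "0 < L"
    "\<And>u v. a \<le> u \<Longrightarrow> a \<le> v \<Longrightarrow> \<bar>limit_shape u q - limit_shape v q\<bar> \<le> L * \<bar>u - v\<bar>"
proof
  define L where "L = q + 1 / (exp a - 1)"
  show "0 < L" using assms by (simp add: L_def add_nonneg_pos)
  fix u v assume uv: "a \<le> u" "a \<le> v"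
  have "norm (profile q u - profile q v) \<le> L * norm (u - v)"
  proof (rule field_differentiable_bound)
    show "convex {a..}" by simp
    fix w assume w: "w \<in> {a..}"
    show "(profile q has_field_derivative - q - 1 / (exp w - 1)) (at w within {a..})"
      using w assms by (auto intro: has_field_derivative_at_within[OF has_field_derivative_profile])
    have "0 < exp a - 1" "exp a \<le> exp w" using w assms by auto
    then have "1 / (exp w - 1) \<le> 1 / (exp a - 1)" "0 \<le> 1 / (exp w - 1)"
      by (auto intro!: divide_left_mono mult_pos_pos)
    then show "norm (- q - 1 / (exp w - 1)) \<le> L"
      using assms unfolding L_def real_norm_def by linarith
  qed (use uv in auto)
  then show "\<bar>limit_shape u q - limit_shape v q\<bar> \<le> L * \<bar>u - v\<bar>"
    unfolding limit_shape_eq_profile by (auto simp: max_def)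
qed

definition profile_primitive :: "real \<Rightarrow> real \<Rightarrow> real" where
  "profile_primitive q u = q * u\<^sup>2 / 2 + Li2 (exp (- u))"

lemma profile_primitive_derivative:
  assumes "0 < u"
  shows "(profile_primitive q has_field_derivative - profile q u) (at u)"
proof -
  have "((\<lambda>u. Li2 (exp (- u))) has_field_derivative
      (- ln (1 - exp (- u)) / exp (- u)) * (- exp (- u))) (at u)"
    by (rule DERIV_chain2[OF has_field_derivative_Li2])
      (use assms in \<open>auto intro!: derivative_eq_intros\<close>)
  then have "((\<lambda>u. Li2 (exp (- u))) has_field_derivative ln (1 - exp (- u))) (at u)"
    by simp
  then show ?thesis
    unfolding profile_primitive_def[abs_def] profile_def
    by (auto intro!: derivative_eq_intros)
qed

lemma continuous_on_profile_primitive: "continuous_on {0..} (profile_primitive q)"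
  unfolding profile_primitive_def[abs_def]
  by (intro continuous_intros continuous_on_compose2[OF continuous_on_Li2]) auto

text \<open>
  By the mean value theorem the difference is \<open>b - a\<close> times a value of the profile inside the interval,
  and the profile is decreasing.
\<close>
lemma profile_primitive_bounds:
  assumes "0 \<le> q" "0 \<le> a" "a < b"
  shows "profile q b * (b - a) \<le> profile_primitive q a - profile_primitive q b"
    and "0 < a \<Longrightarrow> profile_primitive q a - profile_primitive q b \<le> profile q a * (b - a)"
proof -
  obtain z where z: "a < z" "z < b"
    "profile_primitive q b - profile_primitive q a = (b - a) * - profile q z"
  proof -
    have "\<exists>l z. a < z \<and> z < b \<and> DERIV (profile_primitive q) z :> l \<and>
        profile_primitive q b - profile_primitive q a = (b - a) * l"
    proof (rule MVT)
      show "continuous_on {a..b} (profile_primitive q)"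
        using continuous_on_profile_primitive by (rule continuous_on_subset) (use assms in auto)
      show "profile_primitive q differentiable at x" if "a < x" "x < b" for x
        using profile_primitive_derivative[of x q] that assms
        by (auto simp: real_differentiable_def)
    qed fact
    then obtain l z where lz: "a < z" "z < b" "DERIV (profile_primitive q) z :> l"
        "profile_primitive q b - profile_primitive q a = (b - a) * l" by blast
    have "l = - profile q z"
      using DERIV_unique[OF lz(3) profile_primitive_derivative] lz assms(2) by simp
    then show ?thesis using that lz by simp
  qed
  have "profile q b * (b - a) \<le> profile q z * (b - a)"
    using z assms by (intro mult_right_mono profile_antimono) auto
  then show "profile q b * (b - a) \<le> profile_primitive q a - profile_primitive q b"
    using z by (simp add: algebra_simps)
  assume "0 < a"
  then have "profile q z * (b - a) \<le> profile q a * (b - a)"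
    using z assms by (intro mult_right_mono profile_antimono) auto
  then show "profile_primitive q a - profile_primitive q b \<le> profile q a * (b - a)"
    using z by (simp add: algebra_simps)
qed

lemma T_const:
  assumes "0 < q"
  shows "0 < T_const q" "exp (- q * T_const q) = 1 - exp (- T_const q)"
  using theI'[OF ex1_T_const[OF assms]] unfolding T_const_def by auto

lemma profile_T_const: "0 < q \<Longrightarrow> profile q (T_const q) = 0"
  using T_const[of q] by (simp add: profile_def flip: T_const(2))

lemma theta_pos: 
  assumes "0 \<le> q" shows "0 < theta q"
proof (cases "q = 0")
  case False
  then have "0 < q * (T_const q)\<^sup>2 / 2" "0 \<le> Li2 (1 - exp (- T_const q))"
    using T_const[of q] assms by (auto intro!: Li2_nonneg)
  then show ?thesis using False by (simp add: theta_def)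
qed (simp add: theta_def)

text \<open>
  The integral of the limit shape over \<open>[u, \<infinity>)\<close>, written through a primitive of the profile; for
  \<open>q > 0\<close> the limit shape vanishes beyond \<open>T_const q\<close>.
\<close>
definition tail_area :: "real \<Rightarrow> real \<Rightarrow> real" where
  "tail_area q u = (if q = 0 then profile_primitive 0 u
     else profile_primitive q (min u (T_const q)) - profile_primitive q (T_const q))"

text \<open>
  This is where the constant \<open>theta q\<close> comes from.  For \<open>q > 0\<close>, direct integration produces
  \<open>Li2 1 - Li2 (exp (- T)) - q T\<^sup>2 / 2\<close>, and since \<open>ln (1 - exp (- T)) = - q T\<close> the reflection formula turns
  this into the defining expression of \<open>(theta q)\<^sup>2\<close>.
\<close>
lemma tail_area_0:
  assumes "0 \<le> q"
  shows "tail_area q 0 = (theta q)\<^sup>2"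
proof (cases "q = 0")
  case True
  then show ?thesis by (simp add: tail_area_def profile_primitive_def theta_def Li2_1 power_divide)
next
  case False
  define T where "T = T_const q"
  have T: "0 < T" "1 - exp (- T) = exp (- q * T)"
    using T_const[of q] False assms by (auto simp: T_def)
  have "Li2 (exp (- T)) + Li2 (1 - exp (- T)) + (- T) * (- q * T) = pi\<^sup>2 / 6"
    using Li2_reflection[of "exp (- T)"] T by simp
  moreover have "0 \<le> q * T\<^sup>2 / 2 + Li2 (1 - exp (- T))"
    using assms T(1) by (auto intro!: add_nonneg_nonneg Li2_nonneg)
  ultimately show ?thesis
    using False T(1)
    by (simp add: tail_area_def profile_primitive_def theta_def Li2_1 power2_eq_square field_simps
        flip: T_def)
qed

lemma limit_shape_cutoff:
  assumes "0 < q" "0 < u"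
  shows "limit_shape u q = (if u \<le> T_const q then profile q u else 0)"
  using profile_antimono[of q u "T_const q"] profile_antimono[of q "T_const q" u]
    profile_T_const[of q] T_const[of q] assms
  by (auto simp: limit_shape_eq_profile)

lemma limit_shape_0_eq_profile:
  assumes "0 < u" shows "limit_shape u 0 = profile 0 u"
proof -
  have "ln (1 - exp (- u)) \<le> 0" using assms by simp
  then show ?thesis by (simp add: limit_shape_def profile_def)
qed

text \<open>
  The comparison of a step of a monotone Riemann sum with the integral of the limit shape.  The case
  \<open>a = 0\<close> is included in the lower bound only, the limit shape being unbounded at \<open>0\<close>.
\<close>
lemma tail_area_bounds:
  assumes "0 \<le> q" "0 \<le> a" "a \<le> b" "0 < b"
  shows tail_area_lower: "limit_shape b q * (b - a) \<le> tail_area q a - tail_area q b"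
    and tail_area_upper: "0 < a \<Longrightarrow> tail_area q a - tail_area q b \<le> limit_shape a q * (b - a)"
proof -
  define T where "T = T_const q"
  have *: "limit_shape b q * (b - a) \<le> tail_area q a - tail_area q b \<and>
    (0 < a \<longrightarrow> tail_area q a - tail_area q b \<le> limit_shape a q * (b - a))"
  proof (cases "a = b")
    case False
    with assms have ab: "a < b" by simp
    note P = profile_primitive_bounds[OF assms(1,2)]
    show ?thesis
    proof (cases "q = 0")
      case True
      then show ?thesis using P[OF ab] assms
        by (auto simp: tail_area_def limit_shape_0_eq_profile)
    next
      case False
      have T: "0 < T" "profile q T = 0"
        using T_const[of q] profile_T_const[of q] assms False by (auto simp: T_def)
      have q: "0 < q" using False assms by simp
      consider "b \<le> T" | "a < T" "T < b" | "T \<le> a" by linarith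
      then show ?thesis
      proof cases
        case 1
        then show ?thesis using P[OF ab] assms ab q
          by (auto simp: tail_area_def limit_shape_cutoff simp flip: T_def)
      next
        case 2
        have "profile_primitive q a - profile_primitive q T \<le> limit_shape a q * (b - a)" if "0 < a"
        proof -
          have "profile_primitive q a - profile_primitive q T \<le> limit_shape a q * (T - a)"
            using P(2)[of T] 2 that q by (auto simp: limit_shape_cutoff simp flip: T_def)
          also have "\<dots> \<le> limit_shape a q * (b - a)"
            using 2 by (intro mult_left_mono limit_shape_nonneg) auto
          finally show ?thesis .
        qed
        then show ?thesis using P[of T] 2 assms q T(2)
          by (auto simp: tail_area_def limit_shape_cutoff simp flip: T_def)
      next
        case 3
        then show ?thesis using assms ab q T(1) T(2)
          by (auto simp: tail_area_def limit_shape_cutoff simp flip: T_def)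
      qed
    qed
  qed simp
  from * show "limit_shape b q * (b - a) \<le> tail_area q a - tail_area q b" by blast
  from * show "0 < a \<Longrightarrow> tail_area q a - tail_area q b \<le> limit_shape a q * (b - a)" by blast
qed

lemma tail_area_antimono:
  assumes "0 \<le> q" "0 \<le> a" "a \<le> b"
  shows "tail_area q b \<le> tail_area q a"
proof (cases "b = 0")
  case False
  have "0 \<le> limit_shape b q * (b - a)"
    using assms by (intro mult_nonneg_nonneg limit_shape_nonneg) auto
  then show ?thesis using tail_area_lower[of q a b] assms False by linarith
qed (use assms in auto)

lemma tail_area_tendsto_0:
  assumes "0 \<le> q"
  shows "(tail_area q \<longlongrightarrow> 0) at_top"
proof (cases "q = 0")
  case True
  have "(Li2 \<longlongrightarrow> Li2 0) (at 0 within {0..1})"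
    using continuous_on_Li2 unfolding continuous_on_def by (rule bspec) simp
  moreover have "filterlim (\<lambda>u. exp (- u)) (at 0 within {0..1}) (at_top :: real filter)"
    unfolding filterlim_at
  proof
    show "((\<lambda>u. exp (- u)) \<longlongrightarrow> (0::real)) at_top" by real_asymp
    show "\<forall>\<^sub>F u in at_top. exp (- u) \<in> {0..1} \<and> exp (- u) \<noteq> (0::real)"
      using eventually_ge_at_top[of 0] by eventually_elim auto
  qed
  ultimately show ?thesis
    using filterlim_compose[of Li2] True by (auto simp: tail_area_def[abs_def] profile_primitive_def)
next
  case False
  show ?thesis
  proof (rule tendsto_eventually)
    show "\<forall>\<^sub>F u in at_top. tail_area q u = 0"
      using eventually_ge_at_top[of "T_const q"]
      by eventually_elim (use False in \<open>simp add: tail_area_def min_def\<close>)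
  qed
qed

lemma tail_area_nonneg:
  assumes "0 \<le> q" "0 \<le> u"
  shows "0 \<le> tail_area q u"
proof (rule tendsto_upperbound[OF tail_area_tendsto_0[OF assms(1)]])
  show "\<forall>\<^sub>F x in at_top. tail_area q x \<le> tail_area q u"
    using eventually_ge_at_top[of u] by eventually_elim (use assms in \<open>auto intro: tail_area_antimono\<close>)
qed simp

lemma tail_area_tendsto_at_0:
  assumes "0 \<le> q"
  shows "(tail_area q \<longlongrightarrow> (theta q)\<^sup>2) (at_right 0)"
proof -
  have "continuous_on {0..} (tail_area q)"
  proof (cases "q = 0")
    case True
    then show ?thesis using continuous_on_profile_primitive by (simp add: tail_area_def[abs_def])
  next
    case False
    then show ?thesis unfolding tail_area_def[abs_def] using assms T_const[of q]
      by (auto intro!: continuous_intros continuous_on_compose2[OF continuous_on_profile_primitive])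
  qed
  then have "(tail_area q \<longlongrightarrow> tail_area q 0) (at 0 within {0..})"
    by (auto simp: continuous_on_def)
  then have "(tail_area q \<longlongrightarrow> tail_area q 0) (at_right 0)"
    by (rule tendsto_within_subset) auto
  then show ?thesis using tail_area_0[OF assms] by simp
qed

section \<open>Partitions with prescribed minimal gaps\<close>


definition gap_sum :: "(nat \<Rightarrow> nat) \<Rightarrow> nat \<Rightarrow> nat" where
  "gap_sum qs k = (\<Sum>i<k. qs i)"

text \<open>
  The least weight of a partition with \<open>k\<close> parts, attained when all gaps are minimal.
\<close>
definition min_weight :: "(nat \<Rightarrow> nat) \<Rightarrow> nat \<Rightarrow> nat" where
  "min_weight qs k = (\<Sum>p<k. gap_sum qs (k - p))"

text \<open>
  The partition with \<open>k\<close> parts in which the gap below the part of index \<open>j\<close> exceeds its minimum by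
  \<open>r j\<close>.
\<close>
definition from_gaps :: "(nat \<Rightarrow> nat) \<Rightarrow> nat \<Rightarrow> (nat \<Rightarrow> nat) \<Rightarrow> nat \<Rightarrow> nat" where
  "from_gaps qs k r p = gap_sum qs (k - p) + (\<Sum>j\<in>{p..<k}. r j)"

lemma gap_sum_0 [simp]: "gap_sum qs 0 = 0"
  by (simp add: gap_sum_def)

lemma gap_sum_mono: "i \<le> j \<Longrightarrow> gap_sum qs i \<le> gap_sum qs j"
  unfolding gap_sum_def by (intro sum_mono2) auto

lemma gap_sum_pos:
  assumes "gap_sequence qs" "0 < k"
  shows "1 \<le> gap_sum qs k"
  using gap_sum_mono[of 1 k qs] assms by (simp add: gap_sum_def gap_sequence_def)

lemma from_gaps_step:
  assumes "p < k"
  shows "from_gaps qs k r p = from_gaps qs k r (Suc p) + qs (k - Suc p) + r p"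
proof -
  have "k - p = Suc (k - Suc p)" using assms by simp
  then have "gap_sum qs (k - p) = gap_sum qs (k - Suc p) + qs (k - Suc p)"
    by (simp add: gap_sum_def)
  then show ?thesis
    using assms by (simp add: from_gaps_def sum.atLeast_Suc_lessThan)
qed

lemma from_gaps_beyond: "k \<le> p \<Longrightarrow> from_gaps qs k r p = 0"
  by (simp add: from_gaps_def)

lemma support_from_gaps:
  assumes "gap_sequence qs"
  shows "{i. 0 < from_gaps qs k r i} = {..<k}"
proof -
  have "0 < from_gaps qs k r p" if "p < k" for p
    using gap_sum_pos[OF assms, of "k - p"] that by (simp add: from_gaps_def)
  then show ?thesis
    using from_gaps_beyond[of k _ qs r] by (fastforce simp: not_less[symmetric])
qed

lemma num_parts_from_gaps:
  assumes "gap_sequence qs"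
  shows "num_parts (from_gaps qs k r) = k"
  by (simp add: num_parts_def support_from_gaps[OF assms])

lemma from_gaps_in_gap_partitions:
  assumes "gap_sequence qs"
  shows "from_gaps qs k r \<in> gap_partitions qs"
proof -
  have "from_gaps qs k r (Suc p) \<le> from_gaps qs k r p" for p
    using from_gaps_step[of p k qs r] from_gaps_beyond[of k "Suc p" qs r] by (cases "p < k") auto
  then have "is_partition (from_gaps qs k r)"
    by (simp add: is_partition_def antimono_iff_le_Suc support_from_gaps[OF assms])
  then show ?thesis
    using from_gaps_step[of _ k qs r] by (simp add: gap_partitions_def num_parts_from_gaps[OF assms])
qed

text \<open>
  The excess \<open>r j\<close> lifts the \<open>j + 1\<close> parts of index at most \<open>j\<close>.
\<close>
lemma weight_from_gaps:
  assumes "gap_sequence qs"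
  shows "weight (from_gaps qs k r) = min_weight qs k + (\<Sum>j<k. Suc j * r j)"
proof -
  have "(\<Sum>p<k. \<Sum>j\<in>{p..<k}. r j) = (\<Sum>j<k. Suc j * r j)"
    by (induction k) (simp_all add: sum.distrib)
  moreover have "weight (from_gaps qs k r) = (\<Sum>p<k. from_gaps qs k r p)"
    unfolding weight_def support_from_gaps[OF assms] ..
  ultimately show ?thesis
    unfolding from_gaps_def min_weight_def sum.distrib by simp
qed

lemma support_partition:
  assumes "is_partition lam"
  shows "{i. 0 < lam i} = {..<num_parts lam}"
proof (rule card_subset_eq)
  have fin: "finite {i. 0 < lam i}" using assms by (simp add: is_partition_def)
  show "{i. 0 < lam i} \<subseteq> {..<num_parts lam}"
  proof
    fix i assume "i \<in> {i. 0 < lam i}"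
    then have "{..i} \<subseteq> {i. 0 < lam i}"
      using assms antimonoD[of lam _ i] by (fastforce simp: is_partition_def)
    then have "card {..i} \<le> num_parts lam"
      unfolding num_parts_def by (rule card_mono[OF fin])
    then show "i \<in> {..<num_parts lam}" by simp
  qed
qed (auto simp: num_parts_def)

lemma gap_partition_from_gaps:
  assumes "lam \<in> gap_partitions qs"
  obtains r where "r \<in> extensional {..<num_parts lam}" "lam = from_gaps qs (num_parts lam) r"
proof
  define k where "k = num_parts lam"
  define r where "r = restrict (\<lambda>j. lam j - (lam (Suc j) + qs (k - Suc j))) {..<k}"
  show "r \<in> extensional {..<num_parts lam}" by (simp add: r_def k_def)
  have part: "is_partition lam"
    and gap: "\<And>i. i < k \<Longrightarrow> lam (Suc i) + qs (k - Suc i) \<le> lam i"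
    using assms by (auto simp: gap_partitions_def k_def)
  have "lam p = from_gaps qs k r p" for p
  proof (induction "k - p" arbitrary: p)
    case 0
    then have "p \<notin> {i. 0 < lam i}"
      unfolding support_partition[OF part] by (simp add: k_def)
    then show ?case using 0 from_gaps_beyond[of k p qs r] by simp
  next
    case (Suc d)
    then have "p < k" "lam (Suc p) = from_gaps qs k r (Suc p)" by auto
    then show ?case using gap[of p] from_gaps_step[of p k qs r] by (simp add: r_def)
  qed
  then show "lam = from_gaps qs (num_parts lam) r" by (auto simp: k_def)
qed

lemma num_parts_le_min_weight:
  assumes "gap_sequence qs"
  shows "k \<le> min_weight qs k"
proof -
  have "(\<Sum>p<k. 1) \<le> min_weight qs k"
    unfolding min_weight_def using gap_sum_pos[OF assms] by (intro sum_mono) auto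
  then show ?thesis by simp
qed

text \<open>
  Partitions of a fixed weight lie in the image of a finite box of excesses, so sums over them are
  bounded by products of finite sums.
\<close>
lemma gap_partitions_of_subset:
  assumes "gap_sequence qs" "lam \<in> gap_partitions_of qs n" "num_parts lam = k"
  shows "lam \<in> from_gaps qs k ` PiE {..<k} (\<lambda>_. {..n})" "min_weight qs k \<le> n" "k \<le> n"
proof -
  have lam: "lam \<in> gap_partitions qs" "weight lam = n"
    using assms(2) by (auto simp: gap_partitions_of_def)
  then obtain r where r: "r \<in> extensional {..<k}" "lam = from_gaps qs k r"
    using gap_partition_from_gaps[of lam qs] assms(3) by blast
  have w: "n = min_weight qs k + (\<Sum>j<k. Suc j * r j)"
    using weight_from_gaps[OF assms(1)] lam r by simp
  then show "min_weight qs k \<le> n" by simp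
  then show "k \<le> n" using num_parts_le_min_weight[OF assms(1), of k] by simp
  have "r j \<le> n" if "j < k" for j
  proof -
    have "Suc j * r j \<le> (\<Sum>j<k. Suc j * r j)"
      using that by (intro member_le_sum) auto
    then show ?thesis using w by simp
  qed
  then show "lam \<in> from_gaps qs k ` PiE {..<k} (\<lambda>_. {..n})"
    using r by (auto simp: PiE_def Pi_def)
qed

lemma finite_gap_partitions_of:
  assumes "gap_sequence qs"
  shows "finite (gap_partitions_of qs n)"
proof (rule finite_subset)
  show "gap_partitions_of qs n \<subseteq> (\<Union>k\<le>n. from_gaps qs k ` PiE {..<k} (\<lambda>_. {..n}))"
  proof
    fix lam assume "lam \<in> gap_partitions_of qs n"
    from gap_partitions_of_subset(1,3)[OF assms this refl]
    show "lam \<in> (\<Union>k\<le>n. from_gaps qs k ` PiE {..<k} (\<lambda>_. {..n}))" by auto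
  qed
  show "finite (\<Union>k\<le>n. from_gaps qs k ` PiE {..<k} (\<lambda>_. {..n}))"
    by (intro finite_UN_I finite_imageI finite_PiE) simp_all
qed

lemma inj_on_from_gaps: "inj_on (from_gaps qs k) (PiE {..<k} B)"
proof (rule inj_onI)
  fix r r' assume r: "r \<in> PiE {..<k} B" "r' \<in> PiE {..<k} B"
    and eq: "from_gaps qs k r = from_gaps qs k r'"
  show "r = r'"
  proof (rule PiE_ext[OF r])
    fix j assume "j \<in> {..<k}"
    then show "r j = r' j"
      using from_gaps_step[of j k qs r] from_gaps_step[of j k qs r'] eq by simp
  qed
qed

text \<open>
  The gap conditions bound the largest part from below only, so it may be increased by one.  The bound
  \<open>1 \<le> m\<close> excludes the empty partition, which has no largest part.
\<close>
lemma gap_count_mono: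
  assumes qs: "gap_sequence qs" and "1 \<le> m" "m \<le> n"
  shows "card (gap_partitions_of qs m) \<le> card (gap_partitions_of qs n)"
  using assms(3)
proof (induction n rule: dec_induct)
  case (step n)
  define f :: "(nat \<Rightarrow> nat) \<Rightarrow> nat \<Rightarrow> nat" where "f lam = lam(0 := Suc (lam 0))" for lam
  have "card (gap_partitions_of qs n) \<le> card (gap_partitions_of qs (Suc n))"
  proof (rule card_inj_on_le[OF _ _ finite_gap_partitions_of[OF qs]])
    show "inj_on f (gap_partitions_of qs n)"
    proof (rule inj_onI)
      fix x y assume eq: "f x = f y"
      have "x i = y i" for i
        using fun_cong[OF eq, of i] by (cases "i = 0") (simp_all add: f_def)
      then show "x = y" by blast
    qed
    show "f ` gap_partitions_of qs n \<subseteq> gap_partitions_of qs (Suc n)"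
    proof
      fix mu assume "mu \<in> f ` gap_partitions_of qs n"
      then obtain lam where lam: "lam \<in> gap_partitions_of qs n" "mu = f lam" by blast
      have part: "is_partition lam" and w: "weight lam = n"
        and gap: "\<And>i. i < num_parts lam \<Longrightarrow> lam (Suc i) + qs (num_parts lam - Suc i) \<le> lam i"
        using lam by (auto simp: gap_partitions_of_def gap_partitions_def)
      have "{i. 0 < lam i} \<noteq> {}"
      proof
        assume "{i. 0 < lam i} = {}"
        then have "weight lam = 0" unfolding weight_def by (simp only: sum.empty)
        then show False using w \<open>1 \<le> m\<close> \<open>m \<le> n\<close> by simp
      qed
      then have k: "0 < num_parts lam"
        unfolding support_partition[OF part] by (simp add: lessThan_empty_iff)
      then have "0 \<in> {i. 0 < lam i}" unfolding support_partition[OF part] by simp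
      then have pos: "0 < lam 0" by simp
      have supp: "{i. 0 < mu i} = {i. 0 < lam i}"
        using pos by (auto simp: lam f_def)
      then have num: "num_parts mu = num_parts lam" by (simp add: num_parts_def)
      have "is_partition mu"
        using part unfolding is_partition_def supp antimono_iff_le_Suc
        by (simp add: lam f_def le_SucI)
      moreover have "mu (i + 1) + qs (num_parts mu - (i + 1)) \<le> mu i" if "i < num_parts mu" for i
        using gap[of i] that unfolding num by (cases "i = 0") (simp_all add: lam f_def)
      moreover have "weight mu = Suc n"
      proof -
        obtain k where num_k: "num_parts lam = Suc k" using k by (cases "num_parts lam") auto
        have "weight mu = (\<Sum>i<Suc k. mu i)"
          unfolding weight_def supp support_partition[OF part] num_k ..
        also have "\<dots> = mu 0 + (\<Sum>i<k. mu (Suc i))" by (rule sum.lessThan_Suc_shift)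
        also have "\<dots> = Suc (lam 0 + (\<Sum>i<k. lam (Suc i)))" by (simp add: lam f_def)
        also have "lam 0 + (\<Sum>i<k. lam (Suc i)) = (\<Sum>i<Suc k. lam i)"
          by (rule sum.lessThan_Suc_shift[symmetric])
        also have "\<dots> = n"
          using w unfolding weight_def support_partition[OF part] num_k .
        finally show ?thesis .
      qed
      ultimately show "mu \<in> gap_partitions_of qs (Suc n)"
        by (auto simp: gap_partitions_of_def gap_partitions_def)
    qed
  qed
  with step show ?case by linarith
qed simp

text \<open>
  The exponent is affine in the excesses, so the sum over a box of excesses factorises.  The tilt
  \<open>c\<close> changes exactly the factors of those excesses that lift the part of index \<open>p\<close>.
\<close>
lemma sum_exp_from_gaps:
  fixes s c :: real
  assumes "gap_sequence qs"
  defines "w \<equiv> \<lambda>j p. s * real (Suc j) - (if p \<le> j then c else 0)"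
  shows "(\<Sum>r\<in>PiE {..<k} (\<lambda>_. {..R}).
            exp (c * real (from_gaps qs k r p) - s * real (weight (from_gaps qs k r))))
    = exp (c * real (gap_sum qs (k - p)) - s * real (min_weight qs k))
        * (\<Prod>j<k. \<Sum>i\<le>R. exp (- w j p) ^ i)"
proof -
  have *: "c * real (from_gaps qs k r p) - s * real (weight (from_gaps qs k r))
    = c * real (gap_sum qs (k - p)) - s * real (min_weight qs k) - (\<Sum>j<k. w j p * real (r j))" for r
  proof -
    have "real (\<Sum>j\<in>{p..<k}. r j) = (\<Sum>j<k. if p \<le> j then real (r j) else 0)"
      by (auto simp: sum.If_cases intro!: sum.cong)
    then have "c * real (\<Sum>j\<in>{p..<k}. r j) = (\<Sum>j<k. c * (if p \<le> j then real (r j) else 0))"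
      by (simp only: sum_distrib_left)
    also have "\<dots> = (\<Sum>j<k. (if p \<le> j then c else 0) * real (r j))"
      by (intro sum.cong) auto
    finally have "c * real (\<Sum>j\<in>{p..<k}. r j) = \<dots>" .
    moreover have "(\<Sum>j<k. w j p * real (r j)) = s * real (\<Sum>j<k. Suc j * r j)
        - (\<Sum>j<k. (if p \<le> j then c else 0) * real (r j))"
      unfolding w_def left_diff_distrib sum_subtractf of_nat_sum of_nat_mult sum_distrib_left
      by (simp only: mult.assoc)
    ultimately show ?thesis
      unfolding weight_from_gaps[OF assms(1)] from_gaps_def of_nat_add distrib_left by linarith
  qed
  have "exp (c * real (from_gaps qs k r p) - s * real (weight (from_gaps qs k r)))
    = exp (c * real (gap_sum qs (k - p)) - s * real (min_weight qs k)) * (\<Prod>j<k. exp (- w j p) ^ r j)" for r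
  proof -
    have "exp (- (\<Sum>j<k. w j p * real (r j))) = exp (\<Sum>j<k. real (r j) * - w j p)"
      by (simp add: sum_negf mult.commute)
    also have "\<dots> = (\<Prod>j<k. exp (- w j p) ^ r j)"
      by (simp only: exp_sum exp_of_nat_mult finite_lessThan)
    finally show ?thesis
      unfolding * diff_conv_add_uminus[of _ "sum _ _"] by (simp only: exp_add)
  qed
  then show ?thesis
    by (simp only: prod_sum_PiE finite_lessThan finite_atMost sum_distrib_left)
qed

text \<open>
  The hypothesis on \<open>c\<close> makes every geometric series convergent.
\<close>
lemma gap_partitions_exponential_moment:
  fixes s c :: real and k n :: nat
  assumes "gap_sequence qs" "0 < s" "c < s * real (Suc p)"
  defines "F \<equiv> {lam \<in> gap_partitions_of qs n. num_parts lam = k}"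
  shows "(\<Sum>lam\<in>F. exp (c * real (lam p) - s * real n))
    \<le> exp (c * real (gap_sum qs (k - p)) - s * real (min_weight qs k))
        * (\<Prod>j<k. 1 / (1 - exp (- (s * real (Suc j) - (if p \<le> j then c else 0)))))"
proof -
  define w where "w j = s * real (Suc j) - (if p \<le> j then c else 0)" for j
  have w: "0 < w j" for j
  proof (cases "p \<le> j")
    case True
    then have "s * real (Suc p) \<le> s * real (Suc j)" using assms(2) by (intro mult_left_mono) auto
    then show ?thesis using True assms(3) by (simp add: w_def)
  next
    case False
    then show ?thesis using assms(2) by (simp add: w_def)
  qed
  have "(\<Sum>lam\<in>F. exp (c * real (lam p) - s * real n))
      = (\<Sum>lam\<in>F. exp (c * real (lam p) - s * real (weight lam)))"
    by (intro sum.cong) (auto simp: F_def gap_partitions_of_def)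
  also have "\<dots> \<le> (\<Sum>lam\<in>from_gaps qs k ` PiE {..<k} (\<lambda>_. {..n}).
      exp (c * real (lam p) - s * real (weight lam)))"
    using gap_partitions_of_subset(1)[OF assms(1)]
    by (intro sum_mono2) (auto simp: F_def intro!: finite_PiE)
  also have "\<dots> = (\<Sum>r\<in>PiE {..<k} (\<lambda>_. {..n}).
      exp (c * real (from_gaps qs k r p) - s * real (weight (from_gaps qs k r))))"
    by (subst sum.reindex[OF inj_on_from_gaps]) simp
  also have "\<dots> = exp (c * real (gap_sum qs (k - p)) - s * real (min_weight qs k))
        * (\<Prod>j<k. \<Sum>i\<le>n. exp (- w j) ^ i)"
    unfolding w_def by (rule sum_exp_from_gaps[OF assms(1)])
  also have "\<dots> \<le> exp (c * real (gap_sum qs (k - p)) - s * real (min_weight qs k))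
        * (\<Prod>j<k. 1 / (1 - exp (- w j)))"
  proof (intro mult_left_mono prod_mono conjI)
    fix j
    have y: "0 < exp (- w j)" "exp (- w j) < 1" using w[of j] by auto
    show "0 \<le> (\<Sum>i\<le>n. exp (- w j) ^ i)" by (intro sum_nonneg) auto
    have "(\<Sum>i\<le>n. exp (- w j) ^ i) \<le> (\<Sum>i. exp (- w j) ^ i)"
      using y by (intro sum_le_suminf summable_geometric) auto
    then show "(\<Sum>i\<le>n. exp (- w j) ^ i) \<le> 1 / (1 - exp (- w j))"
      using y by (subst (asm) suminf_geometric) auto
  qed auto
  finally show ?thesis unfolding w_def .
qed

section \<open>Exponential moments of a part\<close>


lemma limit_shape_sum_upper:
  assumes "0 \<le> q" "0 < s" "0 \<le> s * real p - c" "p \<le> k"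
  shows "s * (\<Sum>j\<in>{p..<k}. limit_shape (s * real (Suc j) - c) q)
    \<le> tail_area q (s * real p - c) - tail_area q (s * real k - c)"
  using assms(4)
proof (induction k rule: dec_induct)
  case (step k)
  have "s * real p \<le> s * real k" using step assms(2) by (intro mult_left_mono) auto
  moreover have "s * real (Suc k) = s * real k + s" by (simp add: algebra_simps)
  ultimately have "limit_shape (s * real (Suc k) - c) q * (s * real (Suc k) - c - (s * real k - c))
      \<le> tail_area q (s * real k - c) - tail_area q (s * real (Suc k) - c)"
    using assms(1-3) by (intro tail_area_lower; linarith)
  then show ?case using step by (simp add: algebra_simps)
qed simp

lemma limit_shape_sum_lower:
  assumes "0 \<le> q" "0 < s"
  shows "tail_area q s - tail_area q (s * real (Suc k))
    \<le> s * (\<Sum>j<k. limit_shape (s * real (Suc j)) q)"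
proof (induction k)
  case (Suc k)
  have "tail_area q (s * real (Suc k)) - tail_area q (s * real (Suc (Suc k)))
     \<le> limit_shape (s * real (Suc k)) q * (s * real (Suc (Suc k)) - s * real (Suc k))"
    using assms by (intro tail_area_upper) auto
  with Suc show ?case by (simp add: algebra_simps)
qed simp

text \<open>
  The sum up to \<open>p\<close> is at most the area over \<open>[0, s p]\<close>, and the shifted sum beyond \<open>p\<close> at most the area
  over \<open>[s p - c, \<infinity>)\<close>.  Together these cover the half-line, with the strip between \<open>s p - c\<close> and
  \<open>s p\<close> counted twice (\<open>c > 0\<close>) or left out (\<open>c < 0\<close>); the bound does not depend on \<open>k\<close>.
\<close>
lemma shifted_limit_shape_sum:
  assumes q: "0 \<le> q" and s: "0 < s" and c: "c < s * real p"
  shows "(\<Sum>j<k. limit_shape (s * real (Suc j) - (if p \<le> j then c else 0)) q)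
    \<le> ((theta q)\<^sup>2 + c * limit_shape (s * real p - c) q) / s"
proof -
  let ?S = "\<Sum>j<k. limit_shape (s * real (Suc j) - (if p \<le> j then c else 0)) q"
  have "s * ?S \<le> tail_area q 0 - tail_area q (s * real p) + tail_area q (s * real p - c)"
  proof (cases "p \<le> k")
    case True
    have "{..<k} = {0..<p} \<union> {p..<k}" using True by auto
    then have "?S = (\<Sum>j\<in>{0..<p}. limit_shape (s * real (Suc j) - (if p \<le> j then c else 0)) q)
        + (\<Sum>j\<in>{p..<k}. limit_shape (s * real (Suc j) - (if p \<le> j then c else 0)) q)"
      by (simp add: sum.union_disjoint)
    also have "\<dots> = (\<Sum>j\<in>{0..<p}. limit_shape (s * real (Suc j) - 0) q)
        + (\<Sum>j\<in>{p..<k}. limit_shape (s * real (Suc j) - c) q)"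
      by (intro arg_cong2[of _ _ _ _ "(+)"] sum.cong) auto
    finally have S: "?S = \<dots>" .
    have "0 \<le> tail_area q (s * real k - c)"
      using True c s mult_left_mono[of "real p" "real k" s] by (intro tail_area_nonneg q) linarith
    then show ?thesis
      using limit_shape_sum_upper[OF q s, of 0 0 p] limit_shape_sum_upper[OF q s, of p c k] True c
      unfolding S by (simp add: distrib_left)
  next
    case False
    then have S: "?S = (\<Sum>j\<in>{0..<k}. limit_shape (s * real (Suc j) - 0) q)"
      by (intro sum.cong) auto
    have "0 \<le> tail_area q (s * real p - c)" using c by (intro tail_area_nonneg q) auto
    moreover have "tail_area q (s * real p) \<le> tail_area q (s * real k)"
      using False s by (intro tail_area_antimono q) auto
    ultimately show ?thesis
      using limit_shape_sum_upper[OF q s, of 0 0 k] unfolding S by simp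
  qed
  moreover have "tail_area q (s * real p - c) - tail_area q (s * real p) \<le> c * limit_shape (s * real p - c) q"
  proof (cases "0 \<le> c")
    case True
    then show ?thesis using tail_area_upper[OF q, of "s * real p - c" "s * real p"] c s
      by (simp add: mult.commute)
  next
    case False
    then show ?thesis using tail_area_lower[OF q, of "s * real p" "s * real p - c"] c s
      by (simp add: algebra_simps)
  qed
  ultimately have "s * ?S \<le> (theta q)\<^sup>2 + c * limit_shape (s * real p - c) q"
    using tail_area_0[OF q] by linarith
  then show ?thesis using s by (simp add: pos_le_divide_eq mult.commute)
qed

lemma min_weight_eq: "min_weight qs k = (\<Sum>j<k. gap_sum qs (Suc j))"
proof -
  have "min_weight qs k = (\<Sum>j<k. gap_sum qs (Suc (k - Suc j)))"
    unfolding min_weight_def by (intro sum.cong) (auto simp: Suc_diff_Suc)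
  also have "\<dots> = (\<Sum>j<k. gap_sum qs (Suc j))"
    by (rule sum.nat_diff_reindex)
  finally show ?thesis .
qed

text \<open>
  Each of the \<open>p\<close> largest parts of the minimal partition is at least \<open>gap_sum qs (k - p)\<close>.
\<close>
lemma min_weight_ge_gap_sum:
  assumes "p < k"
  shows "p * gap_sum qs (k - p) \<le> min_weight qs k"
proof -
  have "p * gap_sum qs (k - p) = (\<Sum>i<p. gap_sum qs (k - p))" by simp
  also have "\<dots> \<le> (\<Sum>i<p. gap_sum qs (k - i))"
    by (intro sum_mono gap_sum_mono) auto
  also have "\<dots> \<le> min_weight qs k"
    unfolding min_weight_def using assms by (intro sum_mono2) auto
  finally show ?thesis .
qed

text \<open>
  The growth condition in the form in which it enters the estimates: \<open>Q\<^sub>k = q k + o(k)\<close>.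
\<close>
locale linear_gaps =
  fixes qs :: "nat \<Rightarrow> nat" and q :: real
  assumes gap_seq: "gap_sequence qs"
    and q_nonneg: "0 \<le> q"
    and linear: "\<And>\<delta>. 0 < \<delta> \<Longrightarrow> \<exists>C. \<forall>j. \<bar>real (gap_sum qs j) - q * real j\<bar> \<le> \<delta> * real j + C"
begin

abbreviation "\<theta> \<equiv> theta q"

lemma th_pos: "0 < \<theta>"
  using theta_pos[OF q_nonneg] .

lemma gap_sum_uniform:
  assumes "0 < \<eta>"
  shows "\<forall>\<^sub>F n in sequentially. \<forall>j. real j \<le> B * sqrt (real n) \<longrightarrow>
    \<bar>real (gap_sum qs j) - q * real j\<bar> \<le> \<eta> * sqrt (real n)"
proof -
  define \<delta> where "\<delta> = \<eta> / (2 * (\<bar>B\<bar> + 1))"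
  have d: "0 < \<delta>" using assms by (simp add: \<delta>_def)
  obtain C where C: "\<And>j. \<bar>real (gap_sum qs j) - q * real j\<bar> \<le> \<delta> * real j + C"
    using linear[OF d] by blast
  have "\<forall>\<^sub>F n in sequentially. C \<le> \<eta> / 2 * sqrt (real n)"
    using assms by real_asymp
  then show ?thesis
  proof eventually_elim
    case (elim n)
    show ?case
    proof (intro allI impI)
      fix j assume j: "real j \<le> B * sqrt (real n)"
      have "\<delta> * real j \<le> \<delta> * ((\<bar>B\<bar> + 1) * sqrt (real n))"
        using j d by (intro mult_left_mono order_trans[OF j] mult_right_mono) auto
      also have "\<dots> = \<eta> / 2 * sqrt (real n)" by (simp add: \<delta>_def field_simps)
      finally show "\<bar>real (gap_sum qs j) - q * real j\<bar> \<le> \<eta> * sqrt (real n)"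
        using C[of j] elim by linarith
    qed
  qed
qed

lemma min_weight_uniform:
  assumes "0 < \<eta>" "0 < B"
  shows "\<forall>\<^sub>F n in sequentially. \<forall>k. real k \<le> B * sqrt (real n) \<longrightarrow>
    \<bar>real (min_weight qs k) - q * (\<Sum>j<k. real (Suc j))\<bar> \<le> \<eta> * real n"
proof -
  have "0 < \<eta> / B" using assms by simp
  from gap_sum_uniform[OF this, of B] show ?thesis
  proof eventually_elim
    case (elim n)
    show ?case
    proof (intro allI impI)
      fix k assume k: "real k \<le> B * sqrt (real n)"
      have "\<bar>real (min_weight qs k) - q * (\<Sum>j<k. real (Suc j))\<bar>
        = \<bar>\<Sum>j<k. real (gap_sum qs (Suc j)) - q * real (Suc j)\<bar>"
        by (simp add: min_weight_eq sum_subtractf sum_distrib_left del: of_nat_Suc)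
      also have "\<dots> \<le> (\<Sum>j<k. \<bar>real (gap_sum qs (Suc j)) - q * real (Suc j)\<bar>)"
        by (rule sum_abs)
      also have "\<dots> \<le> (\<Sum>j<k. \<eta> / B * sqrt (real n))"
        using k by (intro sum_mono elim[rule_format]) auto
      also have "\<dots> = real k * (\<eta> / B * sqrt (real n))" by simp
      also have "\<dots> \<le> B * sqrt (real n) * (\<eta> / B * sqrt (real n))"
        using k assms by (intro mult_right_mono) auto
      also have "\<dots> = \<eta> * real n" using assms by (simp add: field_simps)
      finally show "\<bar>real (min_weight qs k) - q * (\<Sum>j<k. real (Suc j))\<bar> \<le> \<eta> * real n" .
    qed
  qed
qed

text \<open>
  For \<open>q > 0\<close> the minimal weight grows quadratically in the number of parts.
\<close>
lemma num_parts_bound: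
  assumes "0 < q"
  obtains B where "0 < B"
    "\<And>n k. 0 < n \<Longrightarrow> min_weight qs k \<le> n \<Longrightarrow> real k \<le> B * sqrt (real n)"
proof -
  obtain C where C: "\<And>j. \<bar>real (gap_sum qs j) - q * real j\<bar> \<le> q / 2 * real j + C"
    using linear[of "q / 2"] assms by auto
  have "0 \<le> C" using C[of 0] by simp
  \<comment> \<open>If \<open>k > B \<surd>n\<close>, the first summand makes the linear error \<open>C k\<close> at most \<open>q k\<^sup>2 / 8\<close>, half of the
    main term \<open>q k\<^sup>2 / 4\<close>, and the other two make what remains exceed \<open>n\<close>.\<close>
  define B where "B = 8 * C / q + 8 / q + 1"
  have B: "8 * C / q \<le> B" "8 / q \<le> B" "1 \<le> B"
    using assms \<open>0 \<le> C\<close> by (auto simp: B_def)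
  have "real k \<le> B * sqrt (real n)" if n: "0 < n" and k: "min_weight qs k \<le> n" for n k
  proof (rule ccontr)
    assume "\<not> ?thesis"
    then have big: "B * sqrt (real n) < real k" by simp
    have "1 \<le> sqrt (real n)" using n by simp
    then have "B \<le> B * sqrt (real n)" using B by simp
    then have kB: "B < real k" using big by simp
    have "(\<Sum>j<k. q / 2 * real (Suc j) - C) \<le> (\<Sum>j<k. real (gap_sum qs (Suc j)))"
    proof (rule sum_mono)
      fix j show "q / 2 * real (Suc j) - C \<le> real (gap_sum qs (Suc j))"
        using C[of "Suc j"] by (simp add: abs_le_iff del: of_nat_Suc)
    qed
    also have "\<dots> = real (min_weight qs k)" by (simp add: min_weight_eq)
    also have "(\<Sum>j<k. q / 2 * real (Suc j) - C) = q / 4 * real k * (real k + 1) - C * real k"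
      by (induction k) (simp_all add: field_simps)
    finally have "q / 4 * real k * (real k + 1) - C * real k \<le> real n" using k by simp
    moreover have "8 * C / q \<le> real k" using B(1) kB by simp
    then have "C \<le> q / 8 * real k" using assms by (simp add: field_simps)
    then have "C * real k \<le> q / 8 * real k * real k" by (intro mult_right_mono) auto
    moreover have "0 \<le> q / 4 * real k" using assms by simp
    ultimately have le: "q / 8 * (real k)\<^sup>2 \<le> real n"
      by (simp add: algebra_simps power2_eq_square)
    have "8 / q \<le> B\<^sup>2" using B mult_mono[of 1 B "8/q" B] assms by (simp add: power2_eq_square)
    then have "8 / q * real n \<le> B\<^sup>2 * real n" by (intro mult_right_mono) auto
    also have "\<dots> = (B * sqrt (real n))\<^sup>2" by (simp add: power_mult_distrib)
    also have "\<dots> < (real k)\<^sup>2" using big B by (intro power_strict_mono) auto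
    finally show False using le assms by (simp add: field_simps)
  qed
  moreover have "0 < B" using B by simp
  ultimately show ?thesis using that by blast
qed

text \<open>
  Up to \<open>o(\<surd>n)\<close>, the gaps may be replaced by the constant \<open>q\<close> in the exponent.  For \<open>q > 0\<close>
  only \<open>k = O(\<surd>n)\<close> occurs, and there the approximation \<open>Q\<^sub>j = q j + o(\<surd>n)\<close> is uniform.  For
  \<open>q = 0\<close> the number of parts may be much larger, up to order \<open>n\<close>, and \<open>Q\<^sub>k\<close> need not be \<open>o(\<surd>n)\<close>; but then the gain
  \<open>c Q\<^bsub>k-p\<^esub>\<close> is paid for by the weight of the \<open>p\<close> largest parts of the minimal partition, each
  of which is at least \<open>Q\<^bsub>k-p\<^esub>\<close>.
\<close>
lemma gap_energy_upper:
  assumes "0 < \<eta>" "c \<le> \<theta> * t"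
  shows "\<forall>\<^sub>F n in sequentially. \<forall>k p. min_weight qs k \<le> n \<longrightarrow> t * sqrt (real n) \<le> real p \<longrightarrow>
    c * real (gap_sum qs (k - p)) - \<theta> / sqrt (real n) * real (min_weight qs k)
    \<le> - q * (\<Sum>j<k. \<theta> / sqrt (real n) * real (Suc j) - (if p \<le> j then c else 0)) + \<eta> * sqrt (real n)"
proof (cases "q = 0")
  case True
  show ?thesis using eventually_gt_at_top[of 0]
  proof eventually_elim
    case (elim n)
    show ?case
    proof (intro allI impI)
      fix k p assume p: "t * sqrt (real n) \<le> real p"
      define s where "s = \<theta> / sqrt (real n)"
      have s: "0 < s" using elim th_pos by (simp add: s_def)
      have "s * (t * sqrt (real n)) \<le> s * real p" using p s by (intro mult_left_mono) auto
      then have c: "c \<le> s * real p" using assms(2) elim by (simp add: s_def)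
      have "c * real (gap_sum qs (k - p)) \<le> s * real (min_weight qs k)"
      proof (cases "p < k")
        case True
        have "c * real (gap_sum qs (k - p)) \<le> s * real p * real (gap_sum qs (k - p))"
          using c by (intro mult_right_mono) auto
        also have "\<dots> = s * real (p * gap_sum qs (k - p))" by simp
        also have "\<dots> \<le> s * real (min_weight qs k)"
          using min_weight_ge_gap_sum[OF True, of qs] s by (intro mult_left_mono) (auto simp flip: of_nat_mult)
        finally show ?thesis .
      qed (use s in simp)
      moreover have "0 \<le> \<eta> * sqrt (real n)" using assms(1) by simp
      ultimately have "c * real (gap_sum qs (k - p)) - s * real (min_weight qs k)
        \<le> 0 + \<eta> * sqrt (real n)" by linarith
      then show "c * real (gap_sum qs (k - p)) - \<theta> / sqrt (real n) * real (min_weight qs k)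
        \<le> - q * (\<Sum>j<k. \<theta> / sqrt (real n) * real (Suc j) - (if p \<le> j then c else 0)) + \<eta> * sqrt (real n)"
        unfolding s_def True by simp
    qed
  qed
next
  case False
  then have q: "0 < q" using q_nonneg by simp
  obtain B where B: "0 < B"
    "\<And>n k. 0 < n \<Longrightarrow> min_weight qs k \<le> n \<Longrightarrow> real k \<le> B * sqrt (real n)"
    using num_parts_bound[OF q] by blast
  define d where "d = \<eta> / (2 * (\<bar>c\<bar> + 1))"
  define e where "e = \<eta> / (2 * \<theta>)"
  have d: "0 < d" and e: "0 < e" using assms th_pos by (auto simp: d_def e_def)
  show ?thesis
    using eventually_gt_at_top[of 0] gap_sum_uniform[OF d, of B] min_weight_uniform[OF e B(1)]
  proof eventually_elim
    case (elim n)
    show ?case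
    proof (intro allI impI)
      fix k p assume "min_weight qs k \<le> n" and p: "t * sqrt (real n) \<le> real p"
      then have k: "real k \<le> B * sqrt (real n)" using B(2) elim(1) by blast
      define s where "s = \<theta> / sqrt (real n)"
      have s: "0 < s" using elim th_pos by (simp add: s_def)
      define u where "u = real (gap_sum qs (k - p)) - q * real (k - p)"
      define v where "v = real (min_weight qs k) - q * (\<Sum>j<k. real (Suc j))"
      have u: "\<bar>u\<bar> \<le> d * sqrt (real n)"
        unfolding u_def by (intro elim(2)[rule_format] order_trans[OF _ k]) auto
      have v: "\<bar>v\<bar> \<le> e * real n"
        unfolding v_def using elim(3) k by blast
      have "c * u \<le> \<bar>c\<bar> * \<bar>u\<bar>" by (metis abs_ge_self abs_mult)
      also have "\<dots> \<le> (\<bar>c\<bar> + 1) * (d * sqrt (real n))"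
        using u by (intro mult_mono) auto
      also have "\<dots> = \<eta> / 2 * sqrt (real n)" by (simp add: d_def field_simps)
      finally have cu: "c * u \<le> \<eta> / 2 * sqrt (real n)" .
      have "- v \<le> e * real n" using v by linarith
      then have "s * (- v) \<le> s * (e * real n)" using s by (intro mult_left_mono) auto
      also have "\<dots> = \<eta> / 2 * sqrt (real n)"
        using th_pos elim(1) by (simp add: s_def e_def field_simps)
      finally have sv: "- (s * v) \<le> \<eta> / 2 * sqrt (real n)" by simp
      have "(\<Sum>j<k. if p \<le> j then c else 0) = c * real (k - p)"
      proof -
        have "{..<k} \<inter> {j. p \<le> j} = {p..<k}" by auto
        then show ?thesis by (simp add: sum.If_cases)
      qed
      then have W: "(\<Sum>j<k. s * real (Suc j) - (if p \<le> j then c else 0))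
          = s * (\<Sum>j<k. real (Suc j)) - c * real (k - p)"
        by (simp add: sum_subtractf sum_distrib_left del: of_nat_Suc)
      have "c * real (gap_sum qs (k - p)) - s * real (min_weight qs k)
        = - q * (\<Sum>j<k. s * real (Suc j) - (if p \<le> j then c else 0)) + c * u - s * v"
        unfolding W u_def v_def by (simp add: algebra_simps del: of_nat_Suc)
      then show "c * real (gap_sum qs (k - p)) - \<theta> / sqrt (real n) * real (min_weight qs k)
        \<le> - q * (\<Sum>j<k. \<theta> / sqrt (real n) * real (Suc j) - (if p \<le> j then c else 0)) + \<eta> * sqrt (real n)"
        using cu sv unfolding s_def by linarith
    qed
  qed
qed

text \<open>
  The three contributions to the exponent are \<open>s n = \<theta> \<surd>n\<close> from fixing the weight, \<open>\<theta>\<^sup>2 / s = \<theta> \<surd>n\<close>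
  from the generating function, and the effect of the tilt.  The factor \<open>n + 1\<close> counts the possible numbers of
  parts.
\<close>
lemma exponential_moment_bound:
  assumes "0 < \<eta>" "c < \<theta> * t"
  shows "\<forall>\<^sub>F n in sequentially. \<forall>p. t * sqrt (real n) \<le> real p \<longrightarrow>
    (\<Sum>lam\<in>gap_partitions_of qs n. exp (c * real (lam p)))
    \<le> (real n + 1) * exp (sqrt (real n) *
        (2 * \<theta> + \<eta> + c / \<theta> * limit_shape (\<theta> * real p / sqrt (real n) - c) q))"
proof -
  have "c \<le> \<theta> * t" using assms by simp
  from gap_energy_upper[OF assms(1) this] eventually_gt_at_top[of 0] show ?thesis
  proof eventually_elim
    case (elim n)
    show ?case
    proof (intro allI impI)
      fix p assume p: "t * sqrt (real n) \<le> real p"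
      define s where "s = \<theta> / sqrt (real n)"
      define w where "w j = s * real (Suc j) - (if p \<le> j then c else 0)" for j
      define F where "F k = {lam \<in> gap_partitions_of qs n. num_parts lam = k}" for k
      define X where "X = exp (sqrt (real n) *
        (2 * \<theta> + \<eta> + c / \<theta> * limit_shape (\<theta> * real p / sqrt (real n) - c) q))"
      have s: "0 < s" using elim th_pos by (simp add: s_def)
      have "s * (t * sqrt (real n)) \<le> s * real p" using p s by (intro mult_left_mono) auto
      then have c: "c < s * real p" using assms(2) elim by (simp add: s_def)
      have w: "0 < w j" for j
      proof (cases "p \<le> j")
        case True
        then have "s * real p \<le> s * real (Suc j)" using s by (intro mult_left_mono) auto
        then show ?thesis using True c by (simp add: w_def)
      qed (use s in \<open>simp add: w_def\<close>)
      have F: "(\<Sum>lam\<in>F k. exp (c * real (lam p))) \<le> X" for k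
      proof (cases "F k = {}")
        case False
        then obtain lam where "lam \<in> F k" by blast
        then have k: "min_weight qs k \<le> n"
          using gap_partitions_of_subset(2)[OF gap_seq] by (auto simp: F_def)
        have "(\<Sum>lam\<in>F k. exp (c * real (lam p)))
          = exp (s * real n) * (\<Sum>lam\<in>F k. exp (c * real (lam p) - s * real n))"
          by (simp add: sum_distrib_left exp_diff)
        also have "\<dots> \<le> exp (s * real n) *
            (exp (c * real (gap_sum qs (k - p)) - s * real (min_weight qs k))
              * (\<Prod>j<k. 1 / (1 - exp (- w j))))"
          unfolding F_def w_def using c s
          by (intro mult_left_mono gap_partitions_exponential_moment gap_seq)
            (auto simp: algebra_simps)
        also have "(\<Prod>j<k. 1 / (1 - exp (- w j))) = exp (\<Sum>j<k. - ln (1 - exp (- w j)))"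
        proof -
          have "exp (- ln (1 - exp (- w j))) = 1 / (1 - exp (- w j))" for j
            using w[of j] by (subst exp_minus) (simp add: divide_inverse)
          then show ?thesis by (simp only: exp_sum finite_lessThan)
        qed
        also have "exp (s * real n) * (exp (c * real (gap_sum qs (k - p)) - s * real (min_weight qs k))
              * exp (\<Sum>j<k. - ln (1 - exp (- w j))))
          = exp (s * real n + (c * real (gap_sum qs (k - p)) - s * real (min_weight qs k))
              + (\<Sum>j<k. - ln (1 - exp (- w j))))"
          by (simp only: exp_add mult.assoc)
        also have "\<dots> \<le> X"
          unfolding X_def
        proof (subst exp_le_cancel_iff)
          have "c * real (gap_sum qs (k - p)) - s * real (min_weight qs k)
              \<le> - q * (\<Sum>j<k. w j) + \<eta> * sqrt (real n)"
            unfolding w_def s_def using elim(1) k p by blast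
          then have "c * real (gap_sum qs (k - p)) - s * real (min_weight qs k)
              + (\<Sum>j<k. - ln (1 - exp (- w j))) \<le> (\<Sum>j<k. profile q (w j)) + \<eta> * sqrt (real n)"
            by (simp add: profile_def sum_subtractf sum_negf sum_distrib_left)
          also have "(\<Sum>j<k. profile q (w j)) \<le> (\<Sum>j<k. limit_shape (w j) q)"
            by (intro sum_mono) (simp add: limit_shape_eq_profile)
          also have "\<dots> \<le> (\<theta>\<^sup>2 + c * limit_shape (s * real p - c) q) / s"
            unfolding w_def by (rule shifted_limit_shape_sum[OF q_nonneg s c])
          also have "\<dots> = sqrt (real n) * (\<theta> + c / \<theta> * limit_shape (s * real p - c) q)"
            using th_pos elim(2) by (simp add: s_def field_simps power2_eq_square)
          finally have "c * real (gap_sum qs (k - p)) - s * real (min_weight qs k)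
              + (\<Sum>j<k. - ln (1 - exp (- w j)))
              \<le> sqrt (real n) * (\<theta> + c / \<theta> * limit_shape (s * real p - c) q) + \<eta> * sqrt (real n)"
            by simp
          moreover have "s * real n = \<theta> * sqrt (real n)"
            using elim(2) by (simp add: s_def field_simps)
          ultimately show "s * real n + (c * real (gap_sum qs (k - p)) - s * real (min_weight qs k))
              + (\<Sum>j<k. - ln (1 - exp (- w j)))
            \<le> sqrt (real n) * (2 * \<theta> + \<eta> + c / \<theta> * limit_shape (\<theta> * real p / sqrt (real n) - c) q)"
            by (simp add: s_def algebra_simps)
        qed
        finally show ?thesis .
      qed (simp add: X_def)
      have "(\<Sum>lam\<in>gap_partitions_of qs n. exp (c * real (lam p)))
        = (\<Sum>k\<in>{..n}. \<Sum>lam\<in>F k. exp (c * real (lam p)))"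
        unfolding F_def
        using gap_partitions_of_subset(3)[OF gap_seq]
        by (intro sum.group[symmetric] finite_gap_partitions_of gap_seq) auto
      also have "\<dots> \<le> (\<Sum>k\<in>{..n}. X)" by (intro sum_mono F)
      also have "\<dots> = (real n + 1) * X" by simp
      finally show "(\<Sum>lam\<in>gap_partitions_of qs n. exp (c * real (lam p))) \<le> (real n + 1) * exp (sqrt (real n) *
        (2 * \<theta> + \<eta> + c / \<theta> * limit_shape (\<theta> * real p / sqrt (real n) - c) q))"
        unfolding X_def .
    qed
  qed
qed

lemma gap_count_upper:
  assumes "0 < \<eta>"
  shows "\<forall>\<^sub>F n in sequentially. real (card (gap_partitions_of qs n)) \<le> exp ((2 * \<theta> + \<eta>) * sqrt (real n))"
proof -
  have "\<forall>\<^sub>F n in sequentially. real n + 1 \<le> exp (\<eta> / 2 * sqrt (real n))"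
    using assms by real_asymp
  moreover have "\<forall>\<^sub>F n in sequentially. 1 * sqrt (real n) \<le> real n" by real_asymp
  moreover have "\<forall>\<^sub>F n in sequentially. \<forall>p. 1 * sqrt (real n) \<le> real p \<longrightarrow>
    (\<Sum>lam\<in>gap_partitions_of qs n. exp (0 * real (lam p)))
    \<le> (real n + 1) * exp (sqrt (real n) *
        (2 * \<theta> + \<eta> / 2 + 0 / \<theta> * limit_shape (\<theta> * real p / sqrt (real n) - 0) q))"
    using th_pos assms by (intro exponential_moment_bound) auto
  ultimately show ?thesis
  proof eventually_elim
    case (elim n)
    have "real (card (gap_partitions_of qs n)) \<le> (real n + 1) * exp (sqrt (real n) * (2 * \<theta> + \<eta> / 2))"
      using elim(3)[rule_format, OF elim(2)] by simp
    also have "\<dots> \<le> exp (\<eta> / 2 * sqrt (real n)) * exp (sqrt (real n) * (2 * \<theta> + \<eta> / 2))"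
      using elim(1) by (intro mult_right_mono) auto
    also have "\<dots> = exp ((2 * \<theta> + \<eta>) * sqrt (real n))"
      by (simp add: algebra_simps flip: exp_add)
    finally show ?case .
  qed
qed

end

section \<open>The number of partitions of given weight\<close>


text \<open>
  The optimal number of parts: the profile is decreasing, so keeping exactly the indices at which it is
  non-negative turns the sum of its positive part into an initial sum.
\<close>
lemma limit_shape_sum_eq_profile_sum:
  assumes "0 \<le> q" "0 < s"
  obtains k where "k \<le> K"
    "(\<Sum>j<K. limit_shape (s * real (Suc j)) q) = (\<Sum>j<k. profile q (s * real (Suc j)))"
proof -
  have "\<exists>k\<le>K. (\<Sum>j<K. limit_shape (s * real (Suc j)) q) = (\<Sum>j<k. profile q (s * real (Suc j)))"
  proof (induction K)
    case (Suc K)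
    show ?case
    proof (cases "0 \<le> profile q (s * real (Suc K))")
      case True
      have "limit_shape (s * real (Suc j)) q = profile q (s * real (Suc j))" if "j < Suc K" for j
      proof -
        have "profile q (s * real (Suc K)) \<le> profile q (s * real (Suc j))"
          using that assms by (intro profile_antimono mult_left_mono) auto
        then show ?thesis using True by (simp add: limit_shape_eq_profile)
      qed
      then show ?thesis by (intro exI[of _ "Suc K"]) (auto intro!: sum.cong)
    next
      case False
      then have "limit_shape (s * real (Suc K)) q = 0" by (simp add: limit_shape_eq_profile)
      then show ?thesis using Suc by (auto intro: le_SucI)
    qed
  qed auto
  then show ?thesis using that by blast
qed

context linear_gaps
begin

text \<open>
  When \<open>k exp (- s N) \<le> 1 / 2\<close>, excesses up to \<open>N\<close> already carry half of the full generating
  function of partitions with \<open>k\<close> parts, since each factor loses at most the proportion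
  \<open>exp (- s N)\<close>.  Truncation keeps the weights polynomial in \<open>N\<close>, as the pigeonhole argument
  below requires.
\<close>
lemma truncated_partition_function_lower:
  assumes "0 < s" "1 \<le> N" "real k * exp (- (s * real N)) \<le> 1 / 2"
  shows "exp (- (s * real (min_weight qs k)) + (\<Sum>j<k. - ln (1 - exp (- (s * real (Suc j)))))) / 2
    \<le> (\<Sum>lam\<in>from_gaps qs k ` PiE {..<k} (\<lambda>_. {..N}). exp (- (s * real (weight lam))))"
proof -
  define y where "y j = exp (- (s * real (Suc j)))" for j
  define e where "e = exp (- (s * real N))"
  have y: "0 < y j" "y j < 1" for j using assms(1) by (auto simp: y_def)
  have e: "0 < e" "e < 1" using assms by (auto simp: e_def)
  have "1 / 2 \<le> 1 + real k * (- e)" using assms(3) by (simp add: e_def)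
  also have "\<dots> \<le> (1 + (- e)) ^ k" by (rule Bernoulli_inequality) (use e in simp)
  finally have half: "1 / 2 \<le> (1 - e) ^ k" by simp
  have geo: "(1 - e) * (1 / (1 - y j)) \<le> (\<Sum>i\<le>N. y j ^ i)" for j
  proof -
    have "y j ^ Suc N \<le> y 0 ^ N"
    proof -
      have "y j ^ Suc N \<le> y j ^ N" using y[of j] by (intro power_decreasing) auto
      also have "y j \<le> y 0" using assms(1) by (simp add: y_def)
      then have "y j ^ N \<le> y 0 ^ N" using y[of j] by (intro power_mono) auto
      finally show ?thesis .
    qed
    also have "y 0 ^ N = e" by (simp add: y_def e_def mult.commute flip: exp_of_nat_mult)
    finally have "1 - e \<le> (1 - y j) * (\<Sum>i\<le>N. y j ^ i)"
      unfolding sum_gp_basic by simp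
    then show ?thesis using y[of j] by (simp add: field_simps)
  qed
  have prod: "exp (\<Sum>j<k. - ln (1 - y j)) = (\<Prod>j<k. 1 / (1 - y j))"
  proof -
    have "exp (- ln (1 - y j)) = 1 / (1 - y j)" for j
      using y[of j] by (subst exp_minus) (simp add: divide_inverse)
    then show ?thesis by (simp only: exp_sum finite_lessThan)
  qed
  have "exp (- (s * real (min_weight qs k)) + (\<Sum>j<k. - ln (1 - y j))) / 2
      = exp (- (s * real (min_weight qs k))) * (1 / 2 * (\<Prod>j<k. 1 / (1 - y j)))"
    unfolding exp_add prod by simp
  also have "\<dots> \<le> exp (- (s * real (min_weight qs k))) * ((1 - e) ^ k * (\<Prod>j<k. 1 / (1 - y j)))"
  proof (intro mult_left_mono mult_right_mono half prod_nonneg ballI)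
    show "0 \<le> 1 / (1 - y j)" for j using y[of j] by simp
  qed simp
  also have "(1 - e) ^ k * (\<Prod>j<k. 1 / (1 - y j)) = (\<Prod>j<k. (1 - e) * (1 / (1 - y j)))"
    by (simp only: prod.distrib prod_constant card_lessThan)
  also have "exp (- (s * real (min_weight qs k))) * (\<Prod>j<k. (1 - e) * (1 / (1 - y j)))
      \<le> exp (- (s * real (min_weight qs k))) * (\<Prod>j<k. \<Sum>i\<le>N. y j ^ i)"
  proof (intro mult_left_mono prod_mono conjI geo)
    show "0 \<le> (1 - e) * (1 / (1 - y j))" for j using y[of j] e by simp
  qed simp
  also have "\<dots> = (\<Sum>r\<in>PiE {..<k} (\<lambda>_. {..N}). exp (- (s * real (weight (from_gaps qs k r)))))"
    using sum_exp_from_gaps[OF gap_seq, where c = 0 and s = s and k = k and R = N and p = 0] by (simp add: y_def)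
  also have "\<dots> = (\<Sum>lam\<in>from_gaps qs k ` PiE {..<k} (\<lambda>_. {..N}). exp (- (s * real (weight lam))))"
    by (subst sum.reindex[OF inj_on_from_gaps]) simp
  finally show ?thesis unfolding y_def .
qed

text \<open>
  A single number of parts \<open>k\<close> of order \<open>\<surd>N\<close> suffices: the logarithm of its contribution is a Riemann sum for
  the area under the limit shape up to a large constant \<open>U\<close>.
\<close>
lemma partition_function_lower:
  assumes "0 < \<eta>"
  shows "\<forall>\<^sub>F N in sequentially. exp ((\<theta> - \<eta>) * sqrt (real N))
    \<le> (\<Sum>m\<le>N ^ 3. real (card (gap_partitions_of qs m)) * exp (- (\<theta> / sqrt (real N) * real m)))"
proof -
  \<comment> \<open>The constant \<open>\<eta>'\<close> is chosen so that the three errors, of the tail beyond \<open>U\<close>, of the area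
    below \<open>s\<close>, and of the minimal weight, add up to \<open>\<eta>' + 2 \<eta>' / \<theta> = \<eta> / 2\<close>; the remaining
    \<open>\<eta> / 2\<close> absorbs a factor \<open>2\<close>.\<close>
  define w where "w = 1 + 2 / \<theta>"
  have w: "0 < w" using th_pos by (simp add: w_def add_pos_pos)
  define \<eta>' where "\<eta>' = \<eta> / (2 * w)"
  have e: "0 < \<eta>'" using assms w by (simp add: \<eta>'_def)
  have "\<forall>\<^sub>F u in at_top. tail_area q u < \<eta>'"
    using tail_area_tendsto_0[OF q_nonneg] e by (rule order_tendstoD)
  then obtain U0 where U0: "\<And>u. U0 \<le> u \<Longrightarrow> tail_area q u < \<eta>'"
    unfolding eventually_at_top_linorder by blast
  define U where "U = max U0 1"
  have U: "1 \<le> U" "tail_area q u < \<eta>'" if "U \<le> u" for u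
    using U0 that by (auto simp: U_def)
  have U1: "1 \<le> U" by (simp add: U_def)
  have B: "0 < U / \<theta>" and e2: "0 < \<eta>' / \<theta>" using U1 th_pos e by auto
  have lim: "((\<lambda>N. tail_area q (\<theta> / sqrt (real N))) \<longlongrightarrow> \<theta>\<^sup>2) sequentially"
  proof (rule filterlim_compose[OF tail_area_tendsto_at_0[OF q_nonneg]])
    show "filterlim (\<lambda>N. \<theta> / sqrt (real N)) (at_right 0) sequentially"
      using th_pos by real_asymp
  qed
  have ev1: "\<forall>\<^sub>F N in sequentially. \<theta>\<^sup>2 - \<eta>' < tail_area q (\<theta> / sqrt (real N))"
    by (rule order_tendstoD(1)[OF lim]) (use e in simp)
  have ev2: "\<forall>\<^sub>F N in sequentially. U / \<theta> * sqrt (real N) * exp (- (\<theta> * sqrt (real N))) \<le> 1 / 2"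
    using th_pos U1 by real_asymp
  have ev3: "\<forall>\<^sub>F N in sequentially. (q * (U / \<theta>)\<^sup>2 + \<eta>' / \<theta>) * real N + (U / \<theta>)\<^sup>2 * (real N)\<^sup>2 \<le> real N ^ 3"
    by real_asymp
  have ev4: "\<forall>\<^sub>F N in sequentially. 2 \<le> exp (\<eta> / 2 * sqrt (real N))"
    using assms by real_asymp
  show ?thesis
    using ev1 ev2 ev3 ev4 eventually_gt_at_top[of 0] min_weight_uniform[OF e2 B]
  proof eventually_elim
    case (elim N)
    define s where "s = \<theta> / sqrt (real N)"
    have s: "0 < s" using elim th_pos by (simp add: s_def)
    have sN: "s * real N = \<theta> * sqrt (real N)" using elim(5) by (simp add: s_def field_simps)
    define K where "K = nat \<lfloor>U / s\<rfloor>"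
    have K: "real K \<le> U / s" "U / s < real (Suc K)"
    proof -
      have "0 \<le> U / s" using s U1 by simp
      then have "real K = of_int \<lfloor>U / s\<rfloor>" by (simp add: K_def)
      then show "real K \<le> U / s" "U / s < real (Suc K)"
        using floor_correct[of "U / s"] by (simp_all only: of_nat_Suc) linarith+
    qed
    obtain k where k: "k \<le> K"
      "(\<Sum>j<K. limit_shape (s * real (Suc j)) q) = (\<Sum>j<k. profile q (s * real (Suc j)))"
      using limit_shape_sum_eq_profile_sum[OF q_nonneg s] by metis
    have kU: "real k \<le> U / \<theta> * sqrt (real N)"
    proof -
      have "real k \<le> U / s" using k(1) K(1) by linarith
      then show ?thesis by (simp add: s_def)
    qed
    have S: "\<bar>real (min_weight qs k) - q * (\<Sum>j<k. real (Suc j))\<bar> \<le> \<eta>' / \<theta> * real N"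
      using elim(6) kU by blast
    have "tail_area q (s * real (Suc K)) < \<eta>'"
      using K(2) s by (intro U) (simp add: field_simps)
    then have "\<theta>\<^sup>2 - 2 * \<eta>' \<le> s * (\<Sum>j<k. profile q (s * real (Suc j)))"
      using limit_shape_sum_lower[OF q_nonneg s, of K] elim(1)[folded s_def] unfolding k(2) by linarith
    then have "(\<theta>\<^sup>2 - 2 * \<eta>') / s \<le> (\<Sum>j<k. profile q (s * real (Suc j)))"
      using s by (simp add: field_simps)
    also have "(\<theta>\<^sup>2 - 2 * \<eta>') / s = (\<theta> - 2 * \<eta>' / \<theta>) * sqrt (real N)"
      using th_pos elim(5) by (simp add: s_def field_simps power2_eq_square)
    finally have 1: "(\<theta> - 2 * \<eta>' / \<theta>) * sqrt (real N) \<le> (\<Sum>j<k. profile q (s * real (Suc j)))" .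
    have "s * real (min_weight qs k) \<le> s * (q * (\<Sum>j<k. real (Suc j)) + \<eta>' / \<theta> * real N)"
      using S s by (intro mult_left_mono) auto
    also have "\<dots> = q * (\<Sum>j<k. s * real (Suc j)) + \<eta>' / \<theta> * (s * real N)"
      by (simp add: sum_distrib_left algebra_simps)
    also have "\<eta>' / \<theta> * (s * real N) = \<eta>' * sqrt (real N)" using sN th_pos by simp
    finally have 3: "s * real (min_weight qs k) \<le> q * (\<Sum>j<k. s * real (Suc j)) + \<eta>' * sqrt (real N)" .
    have 4: "(\<Sum>j<k. profile q (s * real (Suc j)))
        = (\<Sum>j<k. - ln (1 - exp (- (s * real (Suc j))))) - q * (\<Sum>j<k. s * real (Suc j))"
      by (simp add: profile_def sum_subtractf sum_negf sum_distrib_left del: of_nat_Suc)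
    have "(\<theta> - 2 * \<eta>' / \<theta> - \<eta>') * sqrt (real N) \<le>
        - (s * real (min_weight qs k)) + (\<Sum>j<k. - ln (1 - exp (- (s * real (Suc j)))))"
      using 1 3 unfolding 4 left_diff_distrib[of _ "\<eta>'"] by linarith
    moreover have "\<theta> - 2 * \<eta>' / \<theta> - \<eta>' = \<theta> - \<eta> / 2"
    proof -
      have "2 * \<eta>' / \<theta> + \<eta>' = \<eta>' * w" by (simp add: w_def algebra_simps)
      also have "\<dots> = \<eta> / 2" using w by (simp add: \<eta>'_def)
      finally show ?thesis by linarith
    qed
    ultimately have 2: "(\<theta> - \<eta> / 2) * sqrt (real N) \<le>
        - (s * real (min_weight qs k)) + (\<Sum>j<k. - ln (1 - exp (- (s * real (Suc j)))))" by simp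
    have "exp ((\<theta> - \<eta>) * sqrt (real N)) * 2 \<le> exp ((\<theta> - \<eta>) * sqrt (real N)) * exp (\<eta> / 2 * sqrt (real N))"
      using elim(4) by (intro mult_left_mono) auto
    also have "\<dots> = exp ((\<theta> - \<eta> / 2) * sqrt (real N))"
      by (simp add: algebra_simps flip: exp_add)
    also have "\<dots> \<le> exp (- (s * real (min_weight qs k)) + (\<Sum>j<k. - ln (1 - exp (- (s * real (Suc j))))))"
      using 2 by simp
    finally have "exp ((\<theta> - \<eta>) * sqrt (real N))
      \<le> exp (- (s * real (min_weight qs k)) + (\<Sum>j<k. - ln (1 - exp (- (s * real (Suc j)))))) / 2" by simp
    also have "\<dots> \<le> (\<Sum>lam\<in>from_gaps qs k ` PiE {..<k} (\<lambda>_. {..N}). exp (- (s * real (weight lam))))"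
    proof (rule truncated_partition_function_lower[OF s])
      show "1 \<le> N" using elim(5) by simp
      have "real k * exp (- (s * real N)) \<le> U / \<theta> * sqrt (real N) * exp (- (s * real N))"
        using kU by (intro mult_right_mono) auto
      then show "real k * exp (- (s * real N)) \<le> 1 / 2" using elim(2) unfolding sN by linarith
    qed
    also have "\<dots> \<le> (\<Sum>lam\<in>(\<Union>m\<le>N ^ 3. gap_partitions_of qs m). exp (- (s * real (weight lam))))"
    proof (rule sum_mono2)
      show "finite (\<Union>m\<le>N ^ 3. gap_partitions_of qs m)"
        using finite_gap_partitions_of[OF gap_seq] by blast
      show "from_gaps qs k ` PiE {..<k} (\<lambda>_. {..N}) \<subseteq> (\<Union>m\<le>N ^ 3. gap_partitions_of qs m)"
      proof safe
        fix r assume r: "r \<in> PiE {..<k} (\<lambda>_. {..N})"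
        have k2: "(real k)\<^sup>2 \<le> (U / \<theta>)\<^sup>2 * real N"
        proof -
          have "(real k)\<^sup>2 \<le> (U / \<theta> * sqrt (real N))\<^sup>2" using kU by (intro power_mono) auto
          also have "\<dots> = (U / \<theta>)\<^sup>2 * real N" by (simp only: power_mult_distrib) simp
          finally show ?thesis .
        qed
        have sumk: "(\<Sum>j<k. real (Suc j)) \<le> (real k)\<^sup>2"
        proof -
          have "(\<Sum>j<k. real (Suc j)) \<le> (\<Sum>j<k. real k)" by (intro sum_mono) auto
          then show ?thesis by (simp add: power2_eq_square)
        qed
        have "real (weight (from_gaps qs k r))
            = real (min_weight qs k) + (\<Sum>j<k. real (Suc j) * real (r j))"
          by (simp only: weight_from_gaps[OF gap_seq] of_nat_add of_nat_sum of_nat_mult)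
        also have "(\<Sum>j<k. real (Suc j) * real (r j)) \<le> (\<Sum>j<k. real (Suc j) * real N)"
          using r by (intro sum_mono mult_left_mono) (auto simp: PiE_def Pi_def)
        also have "\<dots> = (\<Sum>j<k. real (Suc j)) * real N" by (simp only: sum_distrib_right)
        also have "\<dots> \<le> (U / \<theta>)\<^sup>2 * real N * real N"
          using sumk k2 by (intro mult_right_mono) auto
        also have "real (min_weight qs k) \<le> q * (\<Sum>j<k. real (Suc j)) + \<eta>' / \<theta> * real N"
          using S by linarith
        also have "q * (\<Sum>j<k. real (Suc j)) \<le> q * ((U / \<theta>)\<^sup>2 * real N)"
          using sumk k2 q_nonneg by (intro mult_left_mono) auto
        finally have "real (weight (from_gaps qs k r))
          \<le> (q * (U / \<theta>)\<^sup>2 + \<eta>' / \<theta>) * real N + (U / \<theta>)\<^sup>2 * (real N)\<^sup>2"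
          by (simp add: algebra_simps power2_eq_square)
        also note elim(3)
        finally have "weight (from_gaps qs k r) \<le> N ^ 3"
          by (simp flip: of_nat_power)
        then show "from_gaps qs k r \<in> (\<Union>m\<le>N ^ 3. gap_partitions_of qs m)"
          using from_gaps_in_gap_partitions[OF gap_seq] by (auto simp: gap_partitions_of_def)
      qed
    qed auto
    also have "\<dots> = (\<Sum>m\<le>N ^ 3. \<Sum>lam\<in>gap_partitions_of qs m. exp (- (s * real (weight lam))))"
      by (rule sum.UNION_disjoint)
        (auto simp: finite_gap_partitions_of[OF gap_seq], auto simp: gap_partitions_of_def)
    also have "\<dots> = (\<Sum>m\<le>N ^ 3. real (card (gap_partitions_of qs m)) * exp (- (s * real m)))"
      by (intro sum.cong) (auto simp: gap_partitions_of_def)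
    finally show ?case unfolding s_def .
  qed
qed

lemma gap_count_upper_all:
  assumes "0 < \<eta>"
  obtains C where "1 \<le> C"
    "\<And>m. real (card (gap_partitions_of qs m)) \<le> C * exp ((2 * \<theta> + \<eta>) * sqrt (real m))"
proof -
  obtain m0 where m0: "\<And>m. m0 \<le> m \<Longrightarrow>
      real (card (gap_partitions_of qs m)) \<le> exp ((2 * \<theta> + \<eta>) * sqrt (real m))"
    using gap_count_upper[OF assms] unfolding eventually_at_top_linorder by blast
  define C where "C = 1 + (\<Sum>m<m0. real (card (gap_partitions_of qs m)))"
  have C: "1 \<le> C" by (simp add: C_def sum_nonneg)
  have "real (card (gap_partitions_of qs m)) \<le> C * exp ((2 * \<theta> + \<eta>) * sqrt (real m))" for m
  proof (cases "m0 \<le> m")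
    case True
    have "1 * exp ((2 * \<theta> + \<eta>) * sqrt (real m)) \<le> C * exp ((2 * \<theta> + \<eta>) * sqrt (real m))"
      using C by (intro mult_right_mono) auto
    then show ?thesis using m0[OF True] by linarith
  next
    case False
    then have "real (card (gap_partitions_of qs m)) \<le> (\<Sum>m<m0. real (card (gap_partitions_of qs m)))"
      by (intro member_le_sum) auto
    then have "real (card (gap_partitions_of qs m)) \<le> C * 1" by (simp add: C_def)
    also have "\<dots> \<le> C * exp ((2 * \<theta> + \<eta>) * sqrt (real m))"
      using C th_pos assms by (intro mult_left_mono) auto
    finally show ?thesis .
  qed
  with C show ?thesis using that by blast
qed

text \<open>
  With \<open>m = r\<^sup>2 N\<close> and \<open>s = \<theta> / \<surd>N\<close> the upper bound \<open>a(m) \<le> exp ((2\<theta> + \<eta>) \<surd>m)\<close>, up to a constant factor, gives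
  \<open>a(m) exp (- s m)\<close> at most \<open>exp ((\<theta> - \<theta> (1 - r)\<^sup>2 + \<eta> r) \<surd>N)\<close>.  When \<open>r\<close> is not within \<open>\<delta>\<close> of
  \<open>1\<close> this is too small by an exponential factor, whereas some \<open>m \<le> N\<^sup>3\<close> must carry a polynomial share of the
  generating function.
\<close>
lemma gap_count_lower_somewhere:
  assumes "0 < \<delta>" "\<delta> < 1"
  shows "\<forall>\<^sub>F N in sequentially. \<exists>m\<ge>1. real m \<le> (1 + \<delta>)\<^sup>2 * real N \<and>
    exp ((2 * \<theta> * (1 - \<delta>) - \<delta>) * sqrt (real N)) \<le> real (card (gap_partitions_of qs m))"
proof -
  \<comment> \<open>For \<open>\<bar>1 - r\<bar> > \<delta>\<close> this makes \<open>\<eta> r\<close> at most a quarter of \<open>\<theta> (1 - r)\<^sup>2\<close>, and the exponent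
    at most \<open>(\<theta> - 4 \<eta>) \<surd>N\<close>, below the \<open>(\<theta> - 2 \<eta>) \<surd>N\<close> of the generating function.\<close>
  define \<eta> where "\<eta> = \<theta> * \<delta>\<^sup>2 / 8"
  have eta: "0 < \<eta>" using th_pos assms by (simp add: \<eta>_def)
  obtain C where C: "1 \<le> C"
    "\<And>m. real (card (gap_partitions_of qs m)) \<le> C * exp ((2 * \<theta> + \<eta>) * sqrt (real m))"
    using gap_count_upper_all[OF eta] by blast
  have "0 < 2 * \<eta>" using eta by simp
  note ev1 = partition_function_lower[OF this]
  have ev2: "\<forall>\<^sub>F N in sequentially. C * (real N ^ 3 + 1) < exp (2 * \<eta> * sqrt (real N))"
    using eta by real_asymp
  have ev3: "\<forall>\<^sub>F N in sequentially. real N ^ 3 + 1 \<le> exp (\<delta> * sqrt (real N))"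
    using assms by real_asymp
  show ?thesis using ev1 ev2 ev3 eventually_gt_at_top[of 0]
  proof eventually_elim
    case (elim N)
    define s where "s = \<theta> / sqrt (real N)"
    define X where "X = exp ((\<theta> - 2 * \<eta>) * sqrt (real N))"
    define f where "f m = real (card (gap_partitions_of qs m)) * exp (- (s * real m))" for m
    have N: "0 < sqrt (real N)" using elim(4) by simp
    have "\<exists>m\<le>N ^ 3. X / (real N ^ 3 + 1) \<le> f m"
    proof (rule ccontr)
      assume "\<not> ?thesis"
      then have "(\<Sum>m\<le>N ^ 3. f m) < (\<Sum>m\<le>N ^ 3. X / (real N ^ 3 + 1))"
        by (intro sum_strict_mono) auto
      also have "\<dots> = (real N ^ 3 + 1) * (X / (real N ^ 3 + 1))" by (simp add: add.commute)
      also have "\<dots> = X"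
      proof -
        have "0 < real N ^ 3 + 1" by (intro add_nonneg_pos) auto
        then show ?thesis by simp
      qed
      finally show False using elim(1) by (simp add: X_def f_def s_def)
    qed
    then obtain m where m: "X / (real N ^ 3 + 1) \<le> f m" by blast
    define r where "r = sqrt (real m) / sqrt (real N)"
    have rm: "sqrt (real m) = r * sqrt (real N)" using N by (simp add: r_def)
    have sm: "s * real m = \<theta> * r\<^sup>2 * sqrt (real N)"
    proof -
      have "real m = (r * sqrt (real N))\<^sup>2" by (simp flip: rm)
      then show ?thesis using N by (simp add: s_def power2_eq_square field_simps)
    qed
    have r0: "0 \<le> r" by (simp add: r_def)
    have r: "\<bar>1 - r\<bar> \<le> \<delta>"
    proof (rule ccontr)
      assume "\<not> ?thesis"
      then have x: "\<delta> < \<bar>1 - r\<bar>" by simp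
      define x where "x = \<bar>1 - r\<bar>"
      have xd: "\<delta> < x" using x by (simp add: x_def)
      have "f m \<le> C * exp ((2 * \<theta> + \<eta>) * sqrt (real m)) * exp (- (s * real m))"
        unfolding f_def using C(2)[of m] by (intro mult_right_mono) auto
      also have "\<dots> = C * exp (((2 * \<theta> + \<eta>) * r - \<theta> * r\<^sup>2) * sqrt (real N))"
        unfolding sm rm by (simp add: algebra_simps flip: exp_add)
      also have "(2 * \<theta> + \<eta>) * r - \<theta> * r\<^sup>2 = \<theta> - \<theta> * x\<^sup>2 + \<eta> * r"
        by (simp add: x_def power2_eq_square algebra_simps)
      also have "C * exp ((\<theta> - \<theta> * x\<^sup>2 + \<eta> * r) * sqrt (real N)) \<le> C * exp ((\<theta> - 4 * \<eta>) * sqrt (real N))"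
      proof -
        have "\<delta>\<^sup>2 \<le> x\<^sup>2" using xd assms by (intro power_mono) auto
        have "\<delta> * \<delta> \<le> 1 * x" using xd assms by (intro mult_mono) auto
        have "\<delta>\<^sup>2 * r \<le> \<delta>\<^sup>2 * (1 + x)" by (intro mult_left_mono) (auto simp: x_def)
        also have "\<dots> \<le> 2 * x\<^sup>2"
        proof -
          have "\<delta>\<^sup>2 * x \<le> x\<^sup>2"
            using mult_right_mono[OF \<open>\<delta> * \<delta> \<le> 1 * x\<close>, of x] xd assms
            by (simp add: power2_eq_square)
          then show ?thesis using \<open>\<delta>\<^sup>2 \<le> x\<^sup>2\<close> by (simp add: algebra_simps)
        qed
        finally have "\<theta> / 8 * (\<delta>\<^sup>2 * r) \<le> \<theta> / 8 * (2 * x\<^sup>2)" using th_pos by (intro mult_left_mono) auto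
        then have "\<eta> * r \<le> \<theta> * x\<^sup>2 / 4" by (simp add: \<eta>_def)
        moreover have "8 * \<eta> \<le> \<theta> * x\<^sup>2" unfolding \<eta>_def
          using mult_left_mono[OF \<open>\<delta>\<^sup>2 \<le> x\<^sup>2\<close>, of \<theta>] th_pos by simp
        ultimately have "\<theta> - \<theta> * x\<^sup>2 + \<eta> * r \<le> \<theta> - 4 * \<eta>" using eta by linarith
        then show ?thesis using C(1) N by (intro mult_left_mono) auto
      qed
      also have "\<dots> < X / (real N ^ 3 + 1)"
      proof -
        have "C * (real N ^ 3 + 1) * exp ((\<theta> - 4 * \<eta>) * sqrt (real N))
          < exp (2 * \<eta> * sqrt (real N)) * exp ((\<theta> - 4 * \<eta>) * sqrt (real N))"
          using elim(2) by (intro mult_strict_right_mono) auto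
        also have "\<dots> = X" by (simp add: X_def algebra_simps flip: exp_add)
        finally show ?thesis by (subst pos_less_divide_eq) (auto simp: add_nonneg_pos mult_ac)
      qed
      finally show False using m by simp
    qed
    then have r1: "1 - \<delta> \<le> r" "r \<le> 1 + \<delta>" by auto
    have mr: "real m = r\<^sup>2 * real N"
      using rm by (metis of_nat_0_le_iff power_mult_distrib real_sqrt_pow2)
    have "1 \<le> m"
    proof -
      have "0 < sqrt (real m)" using rm r1 assms N by simp
      then show ?thesis by (simp add: Suc_le_eq)
    qed
    moreover have "real m \<le> (1 + \<delta>)\<^sup>2 * real N"
      unfolding mr using r1 r0 by (intro mult_right_mono power_mono) auto
    moreover have "exp ((2 * \<theta> * (1 - \<delta>) - \<delta>) * sqrt (real N)) \<le> real (card (gap_partitions_of qs m))"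
    proof -
      have "(1 - \<delta>)\<^sup>2 \<le> r\<^sup>2" using r1 assms by (intro power_mono) auto
      then have "\<theta> * (1 - \<delta>)\<^sup>2 \<le> \<theta> * r\<^sup>2" using th_pos by (intro mult_left_mono) auto
      moreover have "2 * \<eta> \<le> \<theta> * \<delta>\<^sup>2" using th_pos by (simp add: \<eta>_def)
      ultimately have "2 * \<theta> * (1 - \<delta>) \<le> (\<theta> - 2 * \<eta>) + \<theta> * r\<^sup>2"
        by (simp add: power2_eq_square algebra_simps)
      then have "(2 * \<theta> * (1 - \<delta>) - \<delta>) * sqrt (real N)
          \<le> ((\<theta> - 2 * \<eta>) + \<theta> * r\<^sup>2 - \<delta>) * sqrt (real N)"
        by (intro mult_right_mono) auto
      then have "exp ((2 * \<theta> * (1 - \<delta>) - \<delta>) * sqrt (real N))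
          \<le> exp (((\<theta> - 2 * \<eta>) + \<theta> * r\<^sup>2 - \<delta>) * sqrt (real N))" by simp
      also have "\<dots> = X * exp (s * real m) / exp (\<delta> * sqrt (real N))"
        unfolding sm X_def by (simp add: algebra_simps flip: exp_add exp_diff)
      also have "\<dots> \<le> X * exp (s * real m) / (real N ^ 3 + 1)"
        using elim(3) by (intro divide_left_mono) (auto simp: X_def add_nonneg_pos)
      also have "\<dots> = X / (real N ^ 3 + 1) * exp (s * real m)" by simp
      also have "\<dots> \<le> f m * exp (s * real m)" using m by (intro mult_right_mono) auto
      also have "\<dots> = real (card (gap_partitions_of qs m))"
        by (simp add: f_def flip: exp_add)
      finally show ?thesis .
    qed
    ultimately show ?case by blast
  qed
qed

text \<open>
  Apply the preceding lemma with \<open>N\<close> about \<open>n / (1 + \<delta>)\<^sup>2\<close>, so that the weight it provides is at most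
  \<open>n\<close>, and use monotonicity.
\<close>
lemma gap_count_lower:
  assumes "0 < \<eta>"
  shows "\<forall>\<^sub>F n in sequentially. exp ((2 * \<theta> - \<eta>) * sqrt (real n)) \<le> real (card (gap_partitions_of qs n))"
proof -
  \<comment> \<open>The second bound makes the loss in the exponent at most \<open>\<eta> / 2\<close>, the third keeps the exponent
    \<open>A\<close> defined below non-negative.\<close>
  define \<delta> where "\<delta> = min (1 / 2) (min (\<eta> / (2 * (4 * \<theta> + 1))) (2 * \<theta> / (2 * \<theta> + 1)))"
  have d: "0 < \<delta>" "\<delta> < 1" using assms th_pos by (auto simp: \<delta>_def)
  have d1: "\<delta> * (4 * \<theta> + 1) \<le> \<eta> / 2"
  proof -
    have "\<delta> \<le> \<eta> / (2 * (4 * \<theta> + 1))" by (simp add: \<delta>_def)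
    then show ?thesis using th_pos by (simp add: field_simps)
  qed
  have d2: "\<delta> * (2 * \<theta> + 1) \<le> 2 * \<theta>"
  proof -
    have "\<delta> \<le> 2 * \<theta> / (2 * \<theta> + 1)" by (simp add: \<delta>_def)
    then show ?thesis using th_pos by (simp add: field_simps)
  qed
  define A where "A = 2 * \<theta> * (1 - \<delta>) - \<delta>"
  have A: "0 \<le> A" "A \<le> 2 * \<theta>"
    using d1 d2 d th_pos by (auto simp: A_def algebra_simps add_increasing2)
  have A2: "2 * \<theta> - \<eta> / 2 \<le> A / (1 + \<delta>)"
  proof -
    have "0 \<le> \<eta> * \<delta>" using assms d by simp
    then have "(2 * \<theta> - \<eta> / 2) * (1 + \<delta>) \<le> A"
      using d1 by (simp add: A_def algebra_simps)
    then show ?thesis using d by (simp add: pos_le_divide_eq)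
  qed
  define g where "g n = nat \<lfloor>real n / (1 + \<delta>)\<^sup>2\<rfloor>" for n
  have "filterlim g sequentially sequentially"
    unfolding g_def using d
    by (intro filterlim_compose[OF filterlim_nat_sequentially] filterlim_compose[OF filterlim_floor_sequentially])
       real_asymp
  then have "\<forall>\<^sub>F n in sequentially. \<exists>m\<ge>1. real m \<le> (1 + \<delta>)\<^sup>2 * real (g n) \<and>
      exp (A * sqrt (real (g n))) \<le> real (card (gap_partitions_of qs m))"
    unfolding A_def by (rule eventually_compose_filterlim[OF gap_count_lower_somewhere[OF d]])
  moreover have "\<forall>\<^sub>F n in sequentially. 2 * \<theta> \<le> \<eta> / 2 * sqrt (real n)"
    using assms by real_asymp
  ultimately show ?thesis
  proof eventually_elim
    case (elim n)
    obtain m where m: "1 \<le> m" "real m \<le> (1 + \<delta>)\<^sup>2 * real (g n)"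
      "exp (A * sqrt (real (g n))) \<le> real (card (gap_partitions_of qs m))"
      using elim(1) by blast
    have g: "real (g n) \<le> real n / (1 + \<delta>)\<^sup>2" "real n / (1 + \<delta>)\<^sup>2 \<le> real (g n) + 1"
    proof -
      have "0 \<le> real n / (1 + \<delta>)\<^sup>2" by simp
      then have "real (g n) = of_int \<lfloor>real n / (1 + \<delta>)\<^sup>2\<rfloor>" unfolding g_def by simp
      then show "real (g n) \<le> real n / (1 + \<delta>)\<^sup>2" "real n / (1 + \<delta>)\<^sup>2 \<le> real (g n) + 1"
        by linarith+
    qed
    have "real m \<le> real n" 
    proof -
      have "(1 + \<delta>)\<^sup>2 * real (g n) \<le> real n" using g(1) d by (simp add: field_simps)
      then show ?thesis using m(2) by linarith
    qed
    then have mn: "card (gap_partitions_of qs m) \<le> card (gap_partitions_of qs n)"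
      using m by (intro gap_count_mono gap_seq) auto
    have "sqrt (real n) / (1 + \<delta>) = sqrt (real n / (1 + \<delta>)\<^sup>2)"
      using d by (simp add: real_sqrt_divide)
    also have "\<dots> \<le> sqrt (real (g n) + 1)" using g(2) by simp
    also have "\<dots> \<le> sqrt (real (g n)) + 1"
      using sqrt_add_le_add_sqrt[of "real (g n)" 1] by simp
    finally have "A * (sqrt (real n) / (1 + \<delta>) - 1) \<le> A * sqrt (real (g n))"
      using A by (intro mult_left_mono) auto
    moreover have "(2 * \<theta> - \<eta> / 2) * sqrt (real n) \<le> A / (1 + \<delta>) * sqrt (real n)"
      using A2 by (intro mult_right_mono) auto
    ultimately have "(2 * \<theta> - \<eta>) * sqrt (real n) \<le> A * sqrt (real (g n))"
      using elim(2) A by (simp add: algebra_simps)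
    then have "exp ((2 * \<theta> - \<eta>) * sqrt (real n)) \<le> exp (A * sqrt (real (g n)))" by simp
    also note m(3)
    also have "real (card (gap_partitions_of qs m)) \<le> real (card (gap_partitions_of qs n))" using mn by simp
    finally show ?case .
  qed
qed

end

section \<open>Deviations from the limit shape\<close>


lemma card_exceedance_le:
  fixes c h :: real
  assumes "finite A"
  shows "real (card {x \<in> A. h < c * g x}) * exp h \<le> (\<Sum>x\<in>A. exp (c * g x))"
proof -
  have "real (card {x \<in> A. h < c * g x}) * exp h = (\<Sum>x\<in>{x \<in> A. h < c * g x}. exp h)" by simp
  also have "\<dots> \<le> (\<Sum>x\<in>{x \<in> A. h < c * g x}. exp (c * g x))" by (intro sum_mono) auto
  also have "\<dots> \<le> (\<Sum>x\<in>A. exp (c * g x))" using assms by (intro sum_mono2) auto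
  finally show ?thesis .
qed

context linear_gaps
begin

text \<open>
  Markov's inequality for the tilt \<open>c = \<sigma> b\<close>.  The deviation gains \<open>b \<epsilon> \<surd>n\<close> in the exponent, while
  evaluating the limit shape at \<open>v - c\<close> in place of \<open>v\<close> costs only order \<open>b\<^sup>2 \<surd>n\<close> by the
  Lipschitz bound; so a small \<open>b\<close> leaves a positive rate.
\<close>
lemma one_sided_deviation:
  assumes t: "0 < t" and \<epsilon>: "0 < \<epsilon>" and \<sigma>: "\<sigma> = 1 \<or> \<sigma> = -1"
  obtains \<kappa> where "0 < \<kappa>"
    "\<forall>\<^sub>F n in sequentially. \<forall>p. t * sqrt (real n) \<le> real p \<longrightarrow>
      real (card {lam \<in> gap_partitions_of qs n.
        \<epsilon> < \<sigma> * (real (lam p) / sqrt (real n) - limit_shape (\<theta> * real p / sqrt (real n)) q / \<theta>)})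
      \<le> (real n + 1) * exp ((2 * \<theta> - \<kappa>) * sqrt (real n))"
proof -
  have a: "0 < \<theta> * t / 2" using t th_pos by simp
  obtain L where L: "0 < L"
    "\<And>u v. \<theta> * t / 2 \<le> u \<Longrightarrow> \<theta> * t / 2 \<le> v \<Longrightarrow> \<bar>limit_shape u q - limit_shape v q\<bar> \<le> L * \<bar>u - v\<bar>"
    using limit_shape_lipschitz[OF q_nonneg a] by blast
  \<comment> \<open>The first bound keeps \<open>v - c\<close> in the range of the Lipschitz estimate, the second makes the
    quadratic cost at most a quarter of the gain.\<close>
  define b where "b = min (\<theta> * t / 2) (\<epsilon> * \<theta> / (4 * L))"
  have b: "0 < b" "b \<le> \<theta> * t / 2" "b \<le> \<epsilon> * \<theta> / (4 * L)"
    using a L(1) \<epsilon> th_pos by (auto simp: b_def)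
  have b3: "L * b / \<theta> \<le> \<epsilon> / 4" using b(3) L(1) th_pos by (simp add: field_simps)
  define c where "c = \<sigma> * b"
  have c: "\<bar>c\<bar> = b" "c * \<sigma> = b" using \<sigma> b(1) by (auto simp: c_def)
  define \<eta> where "\<eta> = b * \<epsilon> / 4"
  have eta: "0 < \<eta>" using b \<epsilon> by (simp add: \<eta>_def)
  define \<kappa> where "\<kappa> = b * \<epsilon> / 2"
  have k: "0 < \<kappa>" using b \<epsilon> by (simp add: \<kappa>_def)
  have "c < \<theta> * t" using b a c(1) by linarith
  from exponential_moment_bound[OF eta this] eventually_gt_at_top[of 0]
  have "\<forall>\<^sub>F n in sequentially. \<forall>p. t * sqrt (real n) \<le> real p \<longrightarrow>
      real (card {lam \<in> gap_partitions_of qs n.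
        \<epsilon> < \<sigma> * (real (lam p) / sqrt (real n) - limit_shape (\<theta> * real p / sqrt (real n)) q / \<theta>)})
      \<le> (real n + 1) * exp ((2 * \<theta> - \<kappa>) * sqrt (real n))"
  proof eventually_elim
    case (elim n)
    show ?case
    proof (intro allI impI)
      fix p assume p: "t * sqrt (real n) \<le> real p"
      have n: "0 < sqrt (real n)" using elim(2) by simp
      define v where "v = \<theta> * real p / sqrt (real n)"
      have "\<theta> * (t * sqrt (real n)) \<le> \<theta> * real p" using p th_pos by (intro mult_left_mono) auto
      then have v: "\<theta> * t \<le> v" using n by (simp add: v_def pos_le_divide_eq mult.assoc)
      define h where "h = sqrt (real n) * (c * limit_shape v q / \<theta> + b * \<epsilon>)"
      have eq: "\<epsilon> < \<sigma> * (real m / sqrt (real n) - limit_shape v q / \<theta>) \<longleftrightarrow> h < c * real m" for m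
      proof -
        have "\<epsilon> < \<sigma> * (real m / sqrt (real n) - limit_shape v q / \<theta>)
          \<longleftrightarrow> (sqrt (real n) * b) * \<epsilon>
            < (sqrt (real n) * b) * (\<sigma> * (real m / sqrt (real n) - limit_shape v q / \<theta>))"
          using n b(1) by (subst mult_less_cancel_left_pos) auto
        also have "(sqrt (real n) * b) * (\<sigma> * (real m / sqrt (real n) - limit_shape v q / \<theta>))
          = c * real m - sqrt (real n) * (c * limit_shape v q / \<theta>)"
          using n by (simp add: c_def algebra_simps)
        finally show ?thesis by (simp add: h_def algebra_simps)
      qed
      have "real (card {lam \<in> gap_partitions_of qs n. h < c * real (lam p)}) * exp h
          \<le> (\<Sum>lam\<in>gap_partitions_of qs n. exp (c * real (lam p)))"
        by (intro card_exceedance_le finite_gap_partitions_of gap_seq)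
      also have "\<dots> \<le> (real n + 1) * exp (sqrt (real n) * (2 * \<theta> + \<eta> + c / \<theta> * limit_shape (v - c) q))"
        unfolding v_def using elim(1) p by blast
      finally have "real (card {lam \<in> gap_partitions_of qs n. h < c * real (lam p)})
          \<le> (real n + 1) * exp (sqrt (real n) * (2 * \<theta> + \<eta> + c / \<theta> * limit_shape (v - c) q)) / exp h"
        by (simp add: pos_le_divide_eq)
      also have "\<dots> = (real n + 1) * exp (sqrt (real n) * (2 * \<theta> + \<eta> + c / \<theta> * limit_shape (v - c) q) - h)"
        by (simp add: exp_diff)
      also have "\<dots> \<le> (real n + 1) * exp ((2 * \<theta> - \<kappa>) * sqrt (real n))"
      proof (intro mult_left_mono)
        have "\<bar>limit_shape (v - c) q - limit_shape v q\<bar> \<le> L * \<bar>(v - c) - v\<bar>"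
          using v b c(1) a by (intro L(2)) linarith+
        then have l: "\<bar>limit_shape (v - c) q - limit_shape v q\<bar> \<le> L * b" using c(1) by simp
        have "c / \<theta> * (limit_shape (v - c) q - limit_shape v q)
            \<le> \<bar>c\<bar> / \<theta> * \<bar>limit_shape (v - c) q - limit_shape v q\<bar>"
          using th_pos by (metis abs_ge_self abs_mult abs_divide abs_of_pos)
        also have "\<dots> \<le> b / \<theta> * (L * b)" unfolding c(1)
          using l b th_pos by (intro mult_left_mono) auto
        also have "\<dots> = b * (L * b / \<theta>)" by simp
        also have "\<dots> \<le> b * (\<epsilon> / 4)" using b3 b by (intro mult_left_mono) auto
        finally have "2 * \<theta> + \<eta> + c / \<theta> * (limit_shape (v - c) q - limit_shape v q) - b * \<epsilon> \<le> 2 * \<theta> - \<kappa>"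
          unfolding \<eta>_def \<kappa>_def by linarith
        then have "sqrt (real n) * (2 * \<theta> + \<eta> + c / \<theta> * (limit_shape (v - c) q - limit_shape v q) - b * \<epsilon>)
            \<le> sqrt (real n) * (2 * \<theta> - \<kappa>)" by (intro mult_left_mono) auto
        moreover have "sqrt (real n) * (2 * \<theta> + \<eta> + c / \<theta> * (limit_shape (v - c) q - limit_shape v q) - b * \<epsilon>)
            = sqrt (real n) * (2 * \<theta> + \<eta> + c / \<theta> * limit_shape (v - c) q) - h"
          by (simp add: h_def algebra_simps)
        ultimately show "exp (sqrt (real n) * (2 * \<theta> + \<eta> + c / \<theta> * limit_shape (v - c) q) - h)
            \<le> exp ((2 * \<theta> - \<kappa>) * sqrt (real n))" by (simp add: mult.commute)
      qed simp
      finally show "real (card {lam \<in> gap_partitions_of qs n.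
        \<epsilon> < \<sigma> * (real (lam p) / sqrt (real n) - limit_shape (\<theta> * real p / sqrt (real n)) q / \<theta>)})
        \<le> (real n + 1) * exp ((2 * \<theta> - \<kappa>) * sqrt (real n))"
        unfolding eq[unfolded v_def] .
    qed
  qed
  with k show ?thesis using that by blast
qed

definition deviating :: "real \<Rightarrow> nat \<Rightarrow> nat \<Rightarrow> (nat \<Rightarrow> nat) set" where
  "deviating \<epsilon> n p = {lam \<in> gap_partitions_of qs n.
    \<epsilon> < \<bar>real (lam p) / sqrt (real n) - limit_shape (\<theta> * real p / sqrt (real n)) q / \<theta>\<bar>}"

lemma deviation_count:
  assumes t: "0 < t" and \<epsilon>: "0 < \<epsilon>"
  obtains \<kappa> where "0 < \<kappa>"
    "\<forall>\<^sub>F n in sequentially. \<forall>p. t * sqrt (real n) \<le> real p \<longrightarrow>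
      real (card (deviating \<epsilon> n p)) \<le> 2 * (real n + 1) * exp ((2 * \<theta> - \<kappa>) * sqrt (real n))"
proof -
  let ?D = "\<lambda>\<sigma> n p. {lam \<in> gap_partitions_of qs n.
        \<epsilon> < \<sigma> * (real (lam p) / sqrt (real n) - limit_shape (\<theta> * real p / sqrt (real n)) q / \<theta>)}"
  obtain k1 where k1: "0 < k1" "\<forall>\<^sub>F n in sequentially. \<forall>p. t * sqrt (real n) \<le> real p \<longrightarrow>
      real (card (?D 1 n p)) \<le> (real n + 1) * exp ((2 * \<theta> - k1) * sqrt (real n))"
    using one_sided_deviation[OF t \<epsilon>, of 1] by blast
  obtain k2 where k2: "0 < k2" "\<forall>\<^sub>F n in sequentially. \<forall>p. t * sqrt (real n) \<le> real p \<longrightarrow>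
      real (card (?D (-1) n p)) \<le> (real n + 1) * exp ((2 * \<theta> - k2) * sqrt (real n))"
    using one_sided_deviation[OF t \<epsilon>, of "-1"] by blast
  define \<kappa> where "\<kappa> = min k1 k2"
  have mono: "(real n + 1) * exp ((2 * \<theta> - k) * sqrt (real n))
      \<le> (real n + 1) * exp ((2 * \<theta> - \<kappa>) * sqrt (real n))" if "\<kappa> \<le> k" for k n
    using that by (intro mult_left_mono) (auto intro!: mult_right_mono)
  from k1(2) k2(2) have "\<forall>\<^sub>F n in sequentially. \<forall>p. t * sqrt (real n) \<le> real p \<longrightarrow>
      real (card (deviating \<epsilon> n p)) \<le> 2 * (real n + 1) * exp ((2 * \<theta> - \<kappa>) * sqrt (real n))"
  proof eventually_elim
    case (elim n)
    show ?case
    proof (intro allI impI)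
      fix p assume p: "t * sqrt (real n) \<le> real p"
      have "deviating \<epsilon> n p \<subseteq> ?D 1 n p \<union> ?D (-1) n p"
        unfolding deviating_def by (auto simp: abs_if split: if_splits)
      then have "card (deviating \<epsilon> n p) \<le> card (?D 1 n p \<union> ?D (-1) n p)"
        by (intro card_mono finite_subset[OF _ finite_gap_partitions_of[OF gap_seq, of n]]) auto
      also have "\<dots> \<le> card (?D 1 n p) + card (?D (-1) n p)" by (rule card_Un_le)
      finally have "real (card (deviating \<epsilon> n p)) \<le> real (card (?D 1 n p)) + real (card (?D (-1) n p))"
        by linarith
      also have "real (card (?D 1 n p)) \<le> (real n + 1) * exp ((2 * \<theta> - k1) * sqrt (real n))"
        using elim(1) p by blast
      also have "\<dots> \<le> (real n + 1) * exp ((2 * \<theta> - \<kappa>) * sqrt (real n))"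
        by (rule mono) (simp add: \<kappa>_def)
      also have "real (card (?D (-1) n p)) \<le> (real n + 1) * exp ((2 * \<theta> - k2) * sqrt (real n))"
        using elim(2) p by blast
      also have "\<dots> \<le> (real n + 1) * exp ((2 * \<theta> - \<kappa>) * sqrt (real n))"
        by (rule mono) (simp add: \<kappa>_def)
      finally show "real (card (deviating \<epsilon> n p)) \<le> 2 * (real n + 1) * exp ((2 * \<theta> - \<kappa>) * sqrt (real n))"
        by (simp add: algebra_simps)
    qed
  qed
  moreover have "0 < \<kappa>" using k1 k2 by (simp add: \<kappa>_def)
  ultimately show ?thesis using that by blast
qed

definition off_shape :: "real \<Rightarrow> real \<Rightarrow> nat \<Rightarrow> (nat \<Rightarrow> nat) set" where
  "off_shape t\<^sub>0 \<epsilon> n = {lam \<in> gap_partitions_of qs n.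
      (SUP t\<in>{t\<^sub>0..}. ereal \<bar>young_boundary lam (t * sqrt (real n)) / sqrt (real n)
                                - limit_shape (t * \<theta>) q / \<theta>\<bar>) > ereal \<epsilon>}"

text \<open>
  The boundary is constant between integers and the limit shape is Lipschitz away from \<open>0\<close>, so a deviation at
  \<open>t\<close> is seen, up to \<open>\<epsilon> / 2\<close>, at the integer \<open>p = \<lfloor>t \<surd>n\<rfloor>\<close>.  If this exceeds
  \<open>n\<close>, the part vanishes, as does the one of index \<open>n\<close>, where the limit shape is at least as large.
\<close>
lemma off_shape_subset_deviating:
  assumes t: "0 < t\<^sub>0" and \<epsilon>: "0 < \<epsilon>"
  shows "\<forall>\<^sub>F n in sequentially. off_shape t\<^sub>0 \<epsilon> n
    \<subseteq> (\<Union>p\<in>{p. p \<le> n \<and> t\<^sub>0 / 2 * sqrt (real n) \<le> real p}. deviating (\<epsilon> / 2) n p)"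
proof -
  have a: "0 < \<theta> * t\<^sub>0 / 2" using t th_pos by simp
  obtain L where L: "0 < L"
    "\<And>u v. \<theta> * t\<^sub>0 / 2 \<le> u \<Longrightarrow> \<theta> * t\<^sub>0 / 2 \<le> v \<Longrightarrow> \<bar>limit_shape u q - limit_shape v q\<bar> \<le> L * \<bar>u - v\<bar>"
    using limit_shape_lipschitz[OF q_nonneg a] by blast
  have ev1: "\<forall>\<^sub>F n in sequentially. 1 \<le> t\<^sub>0 / 2 * sqrt (real n)"
    using t by real_asymp
  have ev2: "\<forall>\<^sub>F n in sequentially. L \<le> \<epsilon> / 2 * sqrt (real n)"
    using \<epsilon> by real_asymp
  have ev3: "\<forall>\<^sub>F n in sequentially. t\<^sub>0 / 2 * sqrt (real n) \<le> real n"
    by real_asymp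
  show ?thesis using ev1 ev2 ev3 eventually_gt_at_top[of 0]
  proof eventually_elim
    case (elim n)
    define r where "r = sqrt (real n)"
    have r: "0 < r" "r * r = real n" using elim(4) by (auto simp: r_def)
    show ?case
    proof
      fix lam assume lam: "lam \<in> off_shape t\<^sub>0 \<epsilon> n"
      then have lam_n: "lam \<in> gap_partitions_of qs n"
        and "ereal \<epsilon> < (SUP t\<in>{t\<^sub>0..}. ereal \<bar>young_boundary lam (t * r) / r - limit_shape (t * \<theta>) q / \<theta>\<bar>)"
        by (auto simp: off_shape_def r_def)
      then obtain t where t0: "t\<^sub>0 \<le> t"
        and dev: "\<epsilon> < \<bar>young_boundary lam (t * r) / r - limit_shape (t * \<theta>) q / \<theta>\<bar>"
        by (auto simp: less_SUP_iff)
      have tr: "0 \<le> t * r" using t0 t r by simp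
      define p where "p = nat \<lfloor>t * r\<rfloor>"
      have p: "real p \<le> t * r" "t * r < real p + 1"
      proof -
        have "real p = of_int \<lfloor>t * r\<rfloor>" using tr by (simp add: p_def)
        then show "real p \<le> t * r" "t * r < real p + 1" by linarith+
      qed
      have yb: "young_boundary lam (t * r) = real (lam p)" by (simp add: young_boundary_def p_def)
      have part: "is_partition lam" using lam_n by (auto simp: gap_partitions_of_def gap_partitions_def)
      have "num_parts lam \<le> n"
        using gap_partitions_of_subset(3)[OF gap_seq lam_n refl] .
      then have zero: "lam i = 0" if "n \<le> i" for i
      proof -
        have "i \<notin> {i. 0 < lam i}" unfolding support_partition[OF part]
          using that \<open>num_parts lam \<le> n\<close> by simp
        then show ?thesis by simp
      qed
      show "lam \<in> (\<Union>p\<in>{p. p \<le> n \<and> t\<^sub>0 / 2 * sqrt (real n) \<le> real p}. deviating (\<epsilon> / 2) n p)"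
      proof (cases "p \<le> n")
        case True
        have "t\<^sub>0 * r \<le> t * r" using t0 r by (intro mult_right_mono) auto
        then have pt: "t\<^sub>0 / 2 * r \<le> real p" using p(2) elim(1) unfolding r_def[symmetric] by simp
        define v where "v = \<theta> * real p / r"
        have v: "\<theta> * t\<^sub>0 / 2 \<le> v"
          using mult_left_mono[OF pt, of \<theta>] th_pos r by (simp add: v_def pos_le_divide_eq mult_ac)
        have vt: "\<theta> * t\<^sub>0 / 2 \<le> t * \<theta>"
        proof -
          have "t\<^sub>0 / 2 * \<theta> \<le> t * \<theta>" using t0 t th_pos by (intro mult_right_mono) auto
          then show ?thesis by (simp add: mult_ac)
        qed
        have "\<bar>t * \<theta> - v\<bar> \<le> \<theta> / r"
        proof -
          have "t * \<theta> - v = \<theta> / r * (t * r - real p)" using r by (simp add: v_def field_simps)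
          also have "\<bar>\<dots>\<bar> = \<theta> / r * \<bar>t * r - real p\<bar>" using r th_pos by (simp add: abs_mult)
          also have "\<dots> \<le> \<theta> / r * 1" using p r th_pos by (intro mult_left_mono) auto
          finally show ?thesis by simp
        qed
        then have "L * \<bar>t * \<theta> - v\<bar> \<le> L * (\<theta> / r)" using L by (intro mult_left_mono) auto
        with L(2)[OF vt v] have "\<bar>limit_shape (t * \<theta>) q - limit_shape v q\<bar> \<le> L * (\<theta> / r)" by linarith
        then have "\<bar>limit_shape (t * \<theta>) q - limit_shape v q\<bar> / \<theta> \<le> L * (\<theta> / r) / \<theta>"
          using th_pos by (intro divide_right_mono) auto
        also have "\<dots> = L / r" using th_pos by simp
        also have "\<dots> \<le> \<epsilon> / 2" using elim(2) r unfolding r_def[symmetric] by (simp add: pos_divide_le_eq)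
        finally have "\<bar>limit_shape (t * \<theta>) q / \<theta> - limit_shape v q / \<theta>\<bar> \<le> \<epsilon> / 2"
          using th_pos by (simp flip: diff_divide_distrib)
        then have "\<epsilon> / 2 < \<bar>real (lam p) / r - limit_shape v q / \<theta>\<bar>"
          using dev unfolding yb by linarith
        then have "lam \<in> deviating (\<epsilon> / 2) n p"
          using lam_n by (simp add: deviating_def v_def r_def)
        then show ?thesis using True pt by (auto simp: r_def)
      next
        case False
        have "real n \<le> t * r" using False p(1) by simp
        then have "\<theta> * real n / r \<le> t * \<theta>"
          using th_pos r by (simp add: field_simps)
        moreover have "0 < \<theta> * real n / r" using th_pos r elim(4) by simp
        ultimately have "limit_shape (t * \<theta>) q \<le> limit_shape (\<theta> * real n / r) q"
          by (intro limit_shape_antimono q_nonneg)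
        then have "limit_shape (t * \<theta>) q / \<theta> \<le> limit_shape (\<theta> * real n / r) q / \<theta>"
          using th_pos by (intro divide_right_mono) auto
        moreover have "\<epsilon> < limit_shape (t * \<theta>) q / \<theta>"
          using dev zero[of p] False limit_shape_nonneg[of "t * \<theta>" q] th_pos unfolding yb by simp
        moreover have "real (lam n) / r = 0" using zero[of n] by simp
        ultimately have "\<epsilon> / 2 < \<bar>real (lam n) / r - limit_shape (\<theta> * real n / r) q / \<theta>\<bar>"
          using \<epsilon> by linarith
        then have "lam \<in> deviating (\<epsilon> / 2) n n"
          using lam_n by (simp add: deviating_def r_def)
        then show ?thesis using elim(3) by auto
      qed
    qed
  qed
qed

lemma off_shape_count:
  assumes t: "0 < t\<^sub>0" and \<epsilon>: "0 < \<epsilon>"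
  obtains \<kappa> where "0 < \<kappa>"
    "\<forall>\<^sub>F n in sequentially. real (card (off_shape t\<^sub>0 \<epsilon> n))
      \<le> 2 * (real n + 1)\<^sup>2 * exp ((2 * \<theta> - \<kappa>) * sqrt (real n))"
proof -
  have t2: "0 < t\<^sub>0 / 2" and e2: "0 < \<epsilon> / 2" using assms by auto
  obtain \<kappa> where k: "0 < \<kappa>" and ev: "\<forall>\<^sub>F n in sequentially. \<forall>p. t\<^sub>0 / 2 * sqrt (real n) \<le> real p \<longrightarrow>
      real (card (deviating (\<epsilon> / 2) n p)) \<le> 2 * (real n + 1) * exp ((2 * \<theta> - \<kappa>) * sqrt (real n))"
    using deviation_count[OF t2 e2] by blast
  from ev off_shape_subset_deviating[OF assms]
  have "\<forall>\<^sub>F n in sequentially. real (card (off_shape t\<^sub>0 \<epsilon> n))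
      \<le> 2 * (real n + 1)\<^sup>2 * exp ((2 * \<theta> - \<kappa>) * sqrt (real n))"
  proof eventually_elim
    case (elim n)
    let ?P = "{p. p \<le> n \<and> t\<^sub>0 / 2 * sqrt (real n) \<le> real p}"
    define B where "B = 2 * (real n + 1) * exp ((2 * \<theta> - \<kappa>) * sqrt (real n))"
    have fin: "finite ?P" by simp
    have "card (off_shape t\<^sub>0 \<epsilon> n) \<le> card (\<Union>p\<in>?P. deviating (\<epsilon> / 2) n p)"
    proof (rule card_mono[OF _ elim(2)])
      have "finite (deviating (\<epsilon> / 2) n p)" for p
        unfolding deviating_def using finite_gap_partitions_of[OF gap_seq] by simp
      then show "finite (\<Union>p\<in>?P. deviating (\<epsilon> / 2) n p)" using fin by blast
    qed
    also have "\<dots> \<le> (\<Sum>p\<in>?P. card (deviating (\<epsilon> / 2) n p))" by (rule card_UN_le[OF fin])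
    finally have "real (card (off_shape t\<^sub>0 \<epsilon> n)) \<le> (\<Sum>p\<in>?P. real (card (deviating (\<epsilon> / 2) n p)))"
      by (simp flip: of_nat_sum)
    also have "\<dots> \<le> (\<Sum>p\<in>?P. B)" unfolding B_def using elim(1) by (intro sum_mono) auto
    also have "\<dots> = real (card ?P) * B" by simp
    also have "\<dots> \<le> (real n + 1) * B"
    proof (rule mult_right_mono)
      have "card ?P \<le> card {..n}" by (intro card_mono) auto
      then show "real (card ?P) \<le> real n + 1" by simp
      show "0 \<le> B" by (simp add: B_def)
    qed
    finally show ?case by (simp add: B_def power2_eq_square algebra_simps)
  qed
  with k show ?thesis using that by blast
qed

lemma off_shape_probability_tendsto_0:
  assumes "0 < t\<^sub>0" "0 < \<epsilon>"
  shows "(\<lambda>n. measure (gap_measure qs n) (off_shape t\<^sub>0 \<epsilon> n)) \<longlonglongrightarrow> 0"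
proof -
  obtain \<kappa> where k: "0 < \<kappa>" and ev: "\<forall>\<^sub>F n in sequentially. real (card (off_shape t\<^sub>0 \<epsilon> n))
      \<le> 2 * (real n + 1)\<^sup>2 * exp ((2 * \<theta> - \<kappa>) * sqrt (real n))"
    using off_shape_count[OF assms] by blast
  have "0 < \<kappa> / 2" using k by simp
  from ev gap_count_lower[OF this]
  have "\<forall>\<^sub>F n in sequentially. measure (gap_measure qs n) (off_shape t\<^sub>0 \<epsilon> n)
      \<le> 2 * (real n + 1)\<^sup>2 * exp (- (\<kappa> / 2) * sqrt (real n))"
  proof eventually_elim
    case (elim n)
    have "measure (gap_measure qs n) (off_shape t\<^sub>0 \<epsilon> n)
        = real (card (off_shape t\<^sub>0 \<epsilon> n)) / real (card (gap_partitions_of qs n))"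
      unfolding gap_measure_def
      by (intro measure_uniform_count_measure finite_gap_partitions_of gap_seq) (auto simp: off_shape_def)
    also have "\<dots> \<le> 2 * (real n + 1)\<^sup>2 * exp ((2 * \<theta> - \<kappa>) * sqrt (real n))
        / exp ((2 * \<theta> - \<kappa> / 2) * sqrt (real n))"
      using elim by (intro frac_le) auto
    also have "\<dots> = 2 * (real n + 1)\<^sup>2 * (exp ((2 * \<theta> - \<kappa>) * sqrt (real n))
        / exp ((2 * \<theta> - \<kappa> / 2) * sqrt (real n)))" by simp
    also have "exp ((2 * \<theta> - \<kappa>) * sqrt (real n)) / exp ((2 * \<theta> - \<kappa> / 2) * sqrt (real n))
        = exp (- (\<kappa> / 2) * sqrt (real n))"
      by (simp add: algebra_simps flip: exp_diff)
    finally show ?case .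
  qed
  moreover have "(\<lambda>n. 2 * (real n + 1)\<^sup>2 * exp (- (\<kappa> / 2) * sqrt (real n))) \<longlonglongrightarrow> 0"
    using k by real_asymp
  moreover have "\<forall>\<^sub>F n in sequentially. 0 \<le> measure (gap_measure qs n) (off_shape t\<^sub>0 \<epsilon> n)"
    by simp
  ultimately show ?thesis
    by (rule tendsto_sandwich[OF _ _ tendsto_const, rotated])
qed

end

lemma linear_gapsI:
  assumes "gap_sequence qs" "q \<ge> 0" "\<beta> < 1"
    and O: "(\<lambda>k. real (\<Sum>i<k. qs i) - q * real k) \<in> O(\<lambda>k. real k powr \<beta>)"
  shows "linear_gaps qs q"
proof
  fix \<delta> :: real assume d: "0 < \<delta>"
  have "(\<lambda>k. real k powr \<beta>) \<in> o(\<lambda>k. real k)" using assms(3) by real_asymp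
  then have "(\<lambda>k. real (\<Sum>i<k. qs i) - q * real k) \<in> o(\<lambda>k. real k)"
    using O by (rule landau_o.big_small_trans[rotated])
  then have "\<forall>\<^sub>F k in sequentially. \<bar>real (gap_sum qs k) - q * real k\<bar> \<le> \<delta> * real k"
    using landau_o.smallD[OF _ d] by (force simp: gap_sum_def)
  then obtain k0 where k0: "\<And>k. k0 \<le> k \<Longrightarrow> \<bar>real (gap_sum qs k) - q * real k\<bar> \<le> \<delta> * real k"
    unfolding eventually_at_top_linorder by blast
  define C where "C = (\<Sum>k<k0. \<bar>real (gap_sum qs k) - q * real k\<bar>)"
  have "\<bar>real (gap_sum qs k) - q * real k\<bar> \<le> \<delta> * real k + C" for k
  proof (cases "k0 \<le> k")
    case True
    then show ?thesis using k0[of k] by (simp add: C_def sum_nonneg add_increasing2)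
  next
    case False
    then have "\<bar>real (gap_sum qs k) - q * real k\<bar> \<le> C"
      unfolding C_def by (intro member_le_sum) auto
    moreover have "0 \<le> \<delta> * real k" using d by simp
    ultimately show ?thesis by linarith
  qed
  then show "\<exists>C. \<forall>j. \<bar>real (gap_sum qs j) - q * real j\<bar> \<le> \<delta> * real j + C" by blast
qed fact+

theorem theorem1p1:
  fixes qs :: "nat \<Rightarrow> nat" and q \<beta> t\<^sub>0 \<epsilon> :: real
  assumes "gap_sequence qs"
    and "q \<ge> 0" and "0 \<le> \<beta>" and "\<beta> < 1"
    and "(\<lambda>k. real (\<Sum>i<k. qs i) - q * real k) \<in> O(\<lambda>k. real k powr \<beta>)"
    and "t\<^sub>0 > 0" and "\<epsilon> > 0"
  shows "(\<lambda>n. measure (gap_measure qs n)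
            {lam \<in> gap_partitions_of qs n.
              (SUP t\<in>{t\<^sub>0..}. ereal \<bar>young_boundary lam (t * sqrt (real n)) / sqrt (real n)
                                - limit_shape (t * theta q) q / theta q\<bar>) > ereal \<epsilon>})
         \<longlonglongrightarrow> 0"
proof -
  interpret linear_gaps qs q
    by (rule linear_gapsI[OF assms(1,2,4,5)])
  show ?thesis
    using off_shape_probability_tendsto_0[OF assms(6,7)] unfolding off_shape_def .
qed

end
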